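(* Let $n\ge 2$ and let $u$ be a positive solution of $\Delta_{n/2-1}u=0$ in $B^n$. Then for every $\zeta\in S^{n-1}$, the function $$r\mapsto\left(\frac{1-r}{1+r}\right)^{n-1}u(r\zeta)$$ is decreasing in $r\in[0,1)$, and the function $$r\mapsto\left(\frac{1+r}{1-r}\right)^{n-1}u(r\zeta)$$ is increasing in $r\in[0,1)$.
   Context: $B^n=\{x\in\mathbb{R}^n:|x|<1\}$, $S^{n-1}=\partial B^n$. For $\lambda\in\mathbb{R}$, $\Delta_\lambda=(1-|x|^2)\left\{\frac{1-|x|^2}{4}\sum_j\frac{\partial^2}{\partial x_j^2}+\lambda\sum_j x_j\frac{\partial}{\partial x_j}+\lambda\left(\frac n2-1-\lambda\right)\right\}$. For $\lambda=\frac n2-1$ this is the Laplace-Beltrami operator of the Poincaré metric, $\Delta_{n/2-1}=(1-|x|^2)\left\{\frac{1-|x|^2}{4}\sum_j\frac{\partial^2}{\partial x_j^2}+\left(\frac n2-1\right)\sum_j x_j\frac{\partial}{\partial x_j}\right\}$. It is known (Brelot) that every positive solution of $\Delta_{n/2-1}u=0$ in $B^n$ has the form $u(x)=\int_{S^{n-1}}\left(\frac{1-|x|^2}{|x-\zeta|^2}\right)^{n-1}d\mu(\zeta)$ for some positive Borel measure $\mu$ on $S^{n-1}$. "Decreasing" and "increasing" are meant in the weak (non-strict) sense. *)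

theory Defs
  imports "HOL-Analysis.Analysis"
begin

definition partial_deriv :: "'n \<Rightarrow> (real ^ 'n \<Rightarrow> real) \<Rightarrow> real ^ 'n \<Rightarrow> real" where
  "partial_deriv j f x = deriv (\<lambda>t. f (x + t *\<^sub>R axis j 1)) 0"

text \<open>Both notions are meant for open \<open>S\<close>. Since \<^const>\<open>deriv\<close> is unspecified where the
  derivative does not exist, existence of the partial derivatives is required separately.\<close>

definition C1_on :: "(real ^ 'n) set \<Rightarrow> (real ^ 'n \<Rightarrow> real) \<Rightarrow> bool" where
  "C1_on S f \<longleftrightarrow> continuous_on S f \<and>
     (\<forall>j. (\<forall>x\<in>S. (\<lambda>t. f (x + t *\<^sub>R axis j 1)) field_differentiable at 0) \<and>
          continuous_on S (partial_deriv j f))"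

definition C2_on :: "(real ^ 'n) set \<Rightarrow> (real ^ 'n \<Rightarrow> real) \<Rightarrow> bool" where
  "C2_on S f \<longleftrightarrow> C1_on S f \<and> (\<forall>j. C1_on S (partial_deriv j f))"

definition Delta :: "real \<Rightarrow> (real ^ 'n \<Rightarrow> real) \<Rightarrow> real ^ 'n \<Rightarrow> real" where
  "Delta lam f x =
     (1 - (norm x)\<^sup>2) *
       ((1 - (norm x)\<^sup>2) / 4 * (\<Sum>j\<in>UNIV. partial_deriv j (partial_deriv j f) x)
        + lam * (\<Sum>j\<in>UNIV. x $ j * partial_deriv j f x)
        + lam * (real CARD('n) / 2 - 1 - lam) * f x)"

text \<open>Solutions are classical (\<open>C\<^sup>2\<close>) on the open unit ball; values of \<open>u\<close> outside the ball
  play no role.\<close>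

definition Delta_solution :: "real \<Rightarrow> (real ^ 'n \<Rightarrow> real) \<Rightarrow> bool" where
  "Delta_solution lam u \<longleftrightarrow> C2_on (ball 0 1) u \<and> (\<forall>x\<in>ball 0 1. Delta lam u x = 0)"

end

theory Submission
  imports Defs
begin

text \<open>
  Both monotonicity claims are one sharp Harnack inequality read along a radius: if \<open>d\<close> is the
  hyperbolic distance of \<open>a\<close> and \<open>b\<close>, then \<open>u b \<le> e\<^sup>(\<^sup>n\<^sup>-\<^sup>1\<^sup>)\<^sup>d u a\<close>, and for \<open>a = r \<zeta>\<close>, \<open>b = t \<zeta>\<close> with
  \<open>r \<le> t\<close> one has \<open>e\<^sup>d = (1 + t)(1 - r) / ((1 - t)(1 + r))\<close>.

  The idea is to average \<open>u\<close> against the weight \<open>e\<^sup>-\<^sup>c\<^sup>d\<close> with \<open>c = n - 1 + \<eta>\<close>.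
  Spheres of radius \<open>d\<close> have hyperbolic area of order \<open>e\<^sup>(\<^sup>n\<^sup>-\<^sup>1\<^sup>)\<^sup>d\<close>, so this weight has finite total mass
  for every \<open>\<eta> > 0\<close>, and the mass does not depend on the centre.  By the mean value property
  (\<open>mean_value_property\<close>) the average around a point equals the value of \<open>u\<close> there, up to one universal
  factor.  By the triangle inequality, moving the centre from \<open>b\<close> to \<open>a\<close> changes the weight pointwise
  at most by the factor \<open>e\<^sup>c\<^sup>d\<close>; as \<open>u > 0\<close>, the two averages compare in the same way.  Letting
  \<open>\<eta> \<rightarrow> 0\<close> gives the exponent \<open>n - 1\<close> (\<open>Harnack_inequality\<close>).

  The distance enters only through \<open>s = sinh\<^sup>2 (d / 2)\<close>, a rational function of the two
  points (\<open>sinh_half_sq\<close>), and the weight used is a power of \<open>1 + s = cosh\<^sup>2 (d / 2)\<close>.  The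
  triangle inequality then becomes the elementary estimate \<open>one_plus_sinh_half_sq_on_ray\<close>.

  The mean value property rests on three facts.  The operator is symmetric with respect
  to the hyperbolic volume \<open>dx / (1 - |x|\<^sup>2)\<^sup>n\<close> (\<open>Green_identity\<close>).  On functions of \<open>s\<close> it is an ordinary
  differential operator (\<open>Delta_radial\<close>), and a weight of total mass zero is the image under it of a function that vanishes
  far out (\<open>radial_potential_exists\<close>), so that \<open>u\<close> is orthogonal to every such weight.  Hence the weighted integral of \<open>u\<close>
  around a point depends on the weight only through its mass, and thin shells that shrink to the point
  identify it as a multiple of the value of \<open>u\<close> (\<open>radial_integral_concentrates\<close>).
\<close>

section \<open>Integrals of partial derivatives\<close>

lemma integrable_indicator_cball:
  "integrable lborel (indicat_real (cball (c :: 'a::euclidean_space) r))"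
  using emeasure_lborel_cball_finite[of c r] by (intro integrable_real_indicator) auto

lemma integral_translate_lborel:
  fixes F :: "'a::euclidean_space \<Rightarrow> real"
  assumes [measurable]: "F \<in> borel_measurable borel"
  shows "(\<integral>x. F (x + c) \<partial>lborel) = (\<integral>x. F x \<partial>lborel)"
proof -
  have "(\<integral>x. F x \<partial>lborel) = (\<integral>x. F x \<partial>(distr lborel borel ((+) c)))"
    by (simp add: lborel_distr_plus)
  also have "\<dots> = (\<integral>x. F (c + x) \<partial>lborel)"
    by (subst integral_distr) auto
  finally show ?thesis by (simp add: add.commute)
qed

lemma integrable_bounded_support:
  fixes F :: "'a::euclidean_space \<Rightarrow> real"
  assumes [measurable]: "F \<in> borel_measurable borel"
    and "\<And>x. \<bar>F x\<bar> \<le> B" "\<And>x. norm x > R \<Longrightarrow> F x = 0"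
  shows "integrable lborel F"
proof (rule Bochner_Integration.integrable_bound)
  show "integrable lborel (\<lambda>x. B * indicat_real (cball 0 R) x)"
    by (intro integrable_mult_right integrable_indicator_cball)
  show "AE x in lborel. norm (F x) \<le> norm (B * indicat_real (cball 0 R) x)"
    using assms(2,3) by (auto simp: indicator_def intro!: AE_I2 order_trans[OF assms(2)])
qed simp

text \<open>Difference quotients have integral zero by translation invariance of Lebesgue
  measure.  They converge boundedly to the derivative.\<close>
lemma integral_partial_derivative_zero:
  fixes F g :: "'a::euclidean_space \<Rightarrow> real"
  assumes der: "\<And>x. ((\<lambda>t. F (x + t *\<^sub>R e)) has_real_derivative g x) (at 0)"
    and meas [measurable]: "F \<in> borel_measurable borel"
    and Fb: "\<And>x. \<bar>F x\<bar> \<le> B" and gb: "\<And>x. \<bar>g x\<bar> \<le> M"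
    and supp: "\<And>x. norm x > R \<Longrightarrow> F x = 0"
  shows "integrable lborel g" "(\<integral>x. g x \<partial>lborel) = 0"
proof -
  define h :: "nat \<Rightarrow> real" where "h k = 1 / real (Suc k)" for k
  have h0: "h k > 0" "h k \<le> 1" for k by (auto simp: h_def divide_simps)
  have hlim: "h \<longlonglongrightarrow> 0" unfolding h_def by (rule LIMSEQ_Suc[OF lim_1_over_n])
  define q where "q k x = (F (x + h k *\<^sub>R e) - F x) / h k" for k x
  have [measurable]: "q k \<in> borel_measurable borel" for k unfolding q_def by measurable
  have qlim: "(\<lambda>k. q k x) \<longlonglongrightarrow> g x" for x
  proof -
    have "((\<lambda>t. (F (x + t *\<^sub>R e) - F x) / t) \<longlongrightarrow> g x) (at 0)"
      using der[of x] by (simp add: DERIV_def)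
    moreover have "filterlim h (at 0) sequentially"
      using hlim h0 by (auto simp: filterlim_at intro!: always_eventually less_imp_neq[symmetric])
    ultimately show ?thesis unfolding q_def by (rule filterlim_compose)
  qed
  have [measurable]: "g \<in> borel_measurable borel"
    using borel_measurable_LIMSEQ_real[of borel q g] qlim by simp
  have der': "((\<lambda>t. F (x + t *\<^sub>R e)) has_real_derivative g (x + t *\<^sub>R e)) (at t)" for x t
  proof -
    have "((\<lambda>r. F ((x + t *\<^sub>R e) + r *\<^sub>R e)) has_real_derivative g (x + t *\<^sub>R e)) (at 0)"
      by (rule der)
    then have "((\<lambda>r. F (x + (r + t) *\<^sub>R e)) has_real_derivative g (x + t *\<^sub>R e)) (at 0)"
      by (simp add: scaleR_add_left add_ac)
    then show ?thesis
      using DERIV_at_within_shift[of "\<lambda>t. F (x + t *\<^sub>R e)" "g (x + t *\<^sub>R e)" t 0 UNIV]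
      by (simp add: add.commute)
  qed
  have qb: "\<bar>q k x\<bar> \<le> M" for k x
  proof -
    obtain z where "F (x + h k *\<^sub>R e) - F (x + 0 *\<^sub>R e) = (h k - 0) * g (x + z *\<^sub>R e)"
      using MVT2[of 0 "h k" "\<lambda>t. F (x + t *\<^sub>R e)" "\<lambda>t. g (x + t *\<^sub>R e)"] h0(1)[of k] der' by blast
    then have "q k x = g (x + z *\<^sub>R e)"
      using h0(1)[of k] by (simp add: q_def)
    then show ?thesis using gb by simp
  qed
  define R' where "R' = R + norm e"
  have Fh0: "F (x + h k *\<^sub>R e) = 0" if "norm x > R'" for k x
  proof -
    have "norm x \<le> norm (x + h k *\<^sub>R e) + norm (h k *\<^sub>R e)"
      by (metis add_diff_cancel_right' norm_triangle_ineq4)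
    moreover have "norm (h k *\<^sub>R e) \<le> norm e"
      using h0[of k] by (simp add: mult_left_le_one_le)
    ultimately show ?thesis using that by (intro supp) (auto simp: R'_def)
  qed
  have q0: "q k x = 0" if "norm x > R'" for k x
  proof -
    have "norm x > R" using that norm_ge_zero[of e] unfolding R'_def by linarith
    then show ?thesis by (simp add: q_def supp Fh0[OF that])
  qed
  have iF: "integrable lborel F"
    by (rule integrable_bounded_support[OF meas Fb supp])
  have iFh: "integrable lborel (\<lambda>x. F (x + h k *\<^sub>R e))" for k
    by (rule integrable_bounded_support[of _ B R']) (use Fb Fh0 in auto)
  have qi: "(\<integral>x. q k x \<partial>lborel) = 0" for k
    using iF iFh[of k] by (simp add: q_def integral_translate_lborel)
  define D where "D x = M * indicat_real (cball 0 R') x" for x :: 'a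
  have iD: "integrable lborel D" unfolding D_def
    by (intro integrable_mult_right integrable_indicator_cball)
  have qD: "norm (q k x) \<le> D x" for k x
    using qb[of k x] q0[of x k] by (auto simp: D_def indicator_def)
  have m: "g \<in> borel_measurable lborel" "\<And>k. q k \<in> borel_measurable lborel" by simp_all
  have ae: "AE x in lborel. (\<lambda>k. q k x) \<longlonglongrightarrow> g x" "\<And>k. AE x in lborel. norm (q k x) \<le> D x"
    using qlim qD by simp_all
  show "integrable lborel g"
    by (rule integrable_dominated_convergence[OF m iD ae])
  have "(\<lambda>k. \<integral>x. q k x \<partial>lborel) \<longlonglongrightarrow> (\<integral>x. g x \<partial>lborel)"
    by (rule integral_dominated_convergence[OF m iD ae])
  then show "(\<integral>x. g x \<partial>lborel) = 0"
    using qi by (simp add: LIMSEQ_const_iff)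
qed

section \<open>Green's identity on the ball\<close>

lemma partial_deriv_cong_open:
  assumes "open S" "x \<in> S" "\<And>y. y \<in> S \<Longrightarrow> f y = g y"
  shows "partial_deriv j f x = partial_deriv j g x"
    and "((\<lambda>t. f (x + t *\<^sub>R axis j 1)) has_real_derivative D) (at 0) \<longleftrightarrow>
         ((\<lambda>t. g (x + t *\<^sub>R axis j 1)) has_real_derivative D) (at 0)"
proof -
  have "((\<lambda>t. x + t *\<^sub>R axis j 1) \<longlongrightarrow> x + 0 *\<^sub>R axis j 1) (nhds (0::real))"
    by (intro tendsto_intros filterlim_ident)
  then have "\<forall>\<^sub>F t in nhds 0. x + t *\<^sub>R axis j (1::real) \<in> S"
    using assms(1,2) by (auto intro: topological_tendstoD)
  then have *: "\<forall>\<^sub>F t in nhds 0. f (x + t *\<^sub>R axis j 1) = g (x + t *\<^sub>R axis j 1)"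
    by eventually_elim (use assms(3) in auto)
  show "partial_deriv j f x = partial_deriv j g x"
    unfolding partial_deriv_def by (rule deriv_cong_ev[OF *]) simp
  show "((\<lambda>t. f (x + t *\<^sub>R axis j 1)) has_real_derivative D) (at 0) \<longleftrightarrow>
         ((\<lambda>t. g (x + t *\<^sub>R axis j 1)) has_real_derivative D) (at 0)"
    by (rule DERIV_cong_ev[OF refl * refl])
qed

lemma C1_on_derivative:
  assumes "C1_on S f" "x \<in> S"
  shows "((\<lambda>t. f (x + t *\<^sub>R axis j 1)) has_real_derivative partial_deriv j f x) (at 0)"
  using assms unfolding C1_on_def partial_deriv_def
  by (auto simp: DERIV_deriv_iff_field_differentiable)

lemma C1_onI:
  assumes "open S" "continuous_on S f"
    and "\<And>j x. x \<in> S \<Longrightarrow> ((\<lambda>t. f (x + t *\<^sub>R axis j 1)) has_real_derivative g j x) (at 0)"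
    and "\<And>j. continuous_on S (g j)"
  shows "C1_on S f" "\<And>j x. x \<in> S \<Longrightarrow> partial_deriv j f x = g j x"
proof -
  show *: "partial_deriv j f x = g j x" if "x \<in> S" for j x
    unfolding partial_deriv_def using assms(3)[OF that] by (rule DERIV_imp_deriv)
  show "C1_on S f"
    unfolding C1_on_def using assms * 
    by (auto simp: field_differentiable_def cong: continuous_on_cong)
qed

lemma C1_on_cong:
  assumes "open S" "\<And>x. x \<in> S \<Longrightarrow> f x = g x" "C1_on S g"
  shows "C1_on S f"
proof (rule C1_onI(1)[of S f "\<lambda>j. partial_deriv j g", OF assms(1)])
  show "continuous_on S f" using assms by (auto simp: C1_on_def cong: continuous_on_cong)
  show "((\<lambda>t. f (x + t *\<^sub>R axis j 1)) has_real_derivative partial_deriv j g x) (at 0)" if "x \<in> S" for j x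
    using partial_deriv_cong_open(2)[of S x f g] C1_on_derivative[OF assms(3)] assms(1,2) that by blast
  show "continuous_on S (partial_deriv j g)" for j using assms(3) by (auto simp: C1_on_def)
qed

text \<open>Explicit formulas for the derivatives hold on \<open>S\<close> only, while \<^const>\<open>partial_deriv\<close> is a total function;
  openness of \<open>S\<close> makes the iterated partial derivatives insensitive to the difference.\<close>
lemma C2_onI:
  assumes "open S" "continuous_on S f"
    and "\<And>j x. x \<in> S \<Longrightarrow> ((\<lambda>t. f (x + t *\<^sub>R axis j 1)) has_real_derivative g j x) (at 0)"
    and "\<And>j. continuous_on S (g j)"
    and "\<And>i j x. x \<in> S \<Longrightarrow> ((\<lambda>t. g j (x + t *\<^sub>R axis i 1)) has_real_derivative h i j x) (at 0)"
    and "\<And>i j. continuous_on S (h i j)"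
  shows "C2_on S f" "\<And>j x. x \<in> S \<Longrightarrow> partial_deriv j f x = g j x"
    "\<And>i j x. x \<in> S \<Longrightarrow> partial_deriv i (partial_deriv j f) x = h i j x"
proof -
  note f = C1_onI[OF assms(1-4), simplified]
  have g: "C1_on S (g j)" "\<And>i x. x \<in> S \<Longrightarrow> partial_deriv i (g j) x = h i j x" for j
    using C1_onI[of S "g j" "\<lambda>i. h i j"] assms by blast+
  show "C2_on S f"
    unfolding C2_on_def using f(1) C1_on_cong[OF assms(1) f(2) g(1)] by blast
  show "partial_deriv j f x = g j x" if "x \<in> S" for j x by (rule f(2)[OF that])
  show "partial_deriv i (partial_deriv j f) x = h i j x" if "x \<in> S" for i j x
    using partial_deriv_cong_open(1)[OF assms(1) that f(2)] g(2)[OF that] by simp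
qed

lemma C2_on_derivative:
  assumes "C2_on S f" "x \<in> S"
  shows "((\<lambda>t. f (x + t *\<^sub>R axis j 1)) has_real_derivative partial_deriv j f x) (at 0)"
    "((\<lambda>t. partial_deriv j f (x + t *\<^sub>R axis i 1)) has_real_derivative partial_deriv i (partial_deriv j f) x) (at 0)"
  using assms by (auto simp: C2_on_def intro: C1_on_derivative)

lemma C2_on_continuous:
  assumes "C2_on S f"
  shows "continuous_on S f" "continuous_on S (partial_deriv j f)"
    "continuous_on S (partial_deriv i (partial_deriv j f))"
  using assms by (auto simp: C2_on_def C1_on_def)

lemma norm_sq_derivative:
  "((\<lambda>t. (norm (x + t *\<^sub>R axis j 1 :: real^'n))\<^sup>2) has_real_derivative 2 * x $ j) (at 0)"
proof -
  have "(norm (x + t *\<^sub>R axis j 1 :: real^'n))\<^sup>2 = (norm x)\<^sup>2 + 2 * (x $ j) * t + t\<^sup>2" for t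
    unfolding power2_norm_eq_inner
    by (simp add: inner_add_left inner_add_right inner_axis inner_axis' inner_axis_axis power2_eq_square ring_distribs)
  moreover have "((\<lambda>t. (norm x)\<^sup>2 + 2 * (x $ j) * t + t\<^sup>2) has_real_derivative 2 * x $ j) (at 0)"
    by (auto intro!: derivative_eq_intros)
  ultimately show ?thesis by simp
qed

lemma one_minus_norm_sq_pos: "x \<in> ball 0 1 \<Longrightarrow> 1 - (norm (x :: 'a::real_normed_vector))\<^sup>2 > 0"
  by (simp add: abs_square_less_1)

text \<open>With \<open>X = 1 - |x|\<^sup>2\<close>, the operator is \<open>X\<^sup>n / 4\<close> times the divergence of \<open>X\<^sup>2\<^sup>-\<^sup>n \<nabla>u\<close>,
  so the weighted Wronskian of \<open>u\<close> and \<open>\<psi>\<close> is a divergence.  The left side is that divergence,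
  differentiated out.\<close>
lemma Laplacian_divergence_form:
  fixes u \<psi> :: "real ^ 'n \<Rightarrow> real" and x :: "real ^ 'n"
  defines "n \<equiv> real CARD('n)" and "X \<equiv> 1 - (norm x)\<^sup>2"
  assumes x: "x \<in> ball 0 1"
  shows "(\<Sum>j\<in>UNIV. 2 * (n - 2) * X powr (1 - n) * x $ j * (\<psi> x * partial_deriv j u x - u x * partial_deriv j \<psi> x)
       + X powr (2 - n) * (\<psi> x * partial_deriv j (partial_deriv j u) x - u x * partial_deriv j (partial_deriv j \<psi>) x))
     = 4 * (\<psi> x * Delta (n / 2 - 1) u x - u x * Delta (n / 2 - 1) \<psi> x) / X ^ CARD('n)"
proof -
  have X: "X > 0" using one_minus_norm_sq_pos[OF x] by (simp add: X_def)
  have p: "X powr (2 - n) = X\<^sup>2 / X ^ CARD('n)" "X powr (1 - n) = X / X ^ CARD('n)"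
    using X by (simp_all add: powr_diff n_def powr_realpow)
  have D: "Delta (n / 2 - 1) v x = X * (X / 4 * (\<Sum>j\<in>UNIV. partial_deriv j (partial_deriv j v) x)
        + (n / 2 - 1) * (\<Sum>j\<in>UNIV. x $ j * partial_deriv j v x))" for v
    by (simp add: Delta_def n_def X_def)
  have "(\<Sum>j\<in>UNIV. 2 * (n - 2) * X powr (1 - n) * x $ j * (\<psi> x * partial_deriv j u x - u x * partial_deriv j \<psi> x)
       + X powr (2 - n) * (\<psi> x * partial_deriv j (partial_deriv j u) x - u x * partial_deriv j (partial_deriv j \<psi>) x))
     = 2 * (n - 2) * X powr (1 - n) * (\<psi> x * (\<Sum>j\<in>UNIV. x $ j * partial_deriv j u x)
          - u x * (\<Sum>j\<in>UNIV. x $ j * partial_deriv j \<psi> x))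
       + X powr (2 - n) * (\<psi> x * (\<Sum>j\<in>UNIV. partial_deriv j (partial_deriv j u) x)
          - u x * (\<Sum>j\<in>UNIV. partial_deriv j (partial_deriv j \<psi>) x))"
    by (simp add: sum.distrib sum_subtractf sum_distrib_left algebra_simps)
  also have "\<dots> = 4 * (\<psi> x * Delta (n / 2 - 1) u x - u x * Delta (n / 2 - 1) \<psi> x) / X ^ CARD('n)"
    unfolding D p using X by (simp add: field_simps power2_eq_square)
  finally show ?thesis .
qed

text \<open>The vector field \<open>X\<^sup>2\<^sup>-\<^sup>n (\<psi> \<nabla>u - u \<nabla>\<psi>)\<close> vanishes near the unit sphere because \<open>\<psi>\<close> does, so its
  extension by zero is differentiable on the whole space and its divergence has integral zero.\<close>
lemma Green_identity:
  fixes u \<psi> :: "real ^ 'n \<Rightarrow> real"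
  assumes u: "C2_on (ball 0 1) u" and \<psi>: "C2_on (ball 0 1) \<psi>"
    and R: "R < 1" "\<And>x. x \<in> ball 0 1 \<Longrightarrow> norm x > R \<Longrightarrow> \<psi> x = 0"
  shows "(LINT x:ball 0 1|lborel. (\<psi> x * Delta (real CARD('n) / 2 - 1) u x
      - u x * Delta (real CARD('n) / 2 - 1) \<psi> x) / (1 - (norm x)\<^sup>2) ^ CARD('n)) = 0"
proof -
  define n where "n = real CARD('n)"
  define X where "X x = 1 - (norm (x::real^'n))\<^sup>2" for x
  let ?B = "ball 0 1 :: (real^'n) set"
  have X: "X x > 0" if "x \<in> ?B" for x using one_minus_norm_sq_pos[OF that] by (simp add: X_def)
  define G where "G j x = X x powr (2 - n) * (\<psi> x * partial_deriv j u x - u x * partial_deriv j \<psi> x)" for j x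
  define g where "g j x = 2 * (n - 2) * X x powr (1 - n) * x $ j * (\<psi> x * partial_deriv j u x - u x * partial_deriv j \<psi> x)
       + X x powr (2 - n) * (\<psi> x * partial_deriv j (partial_deriv j u) x - u x * partial_deriv j (partial_deriv j \<psi>) x)" for j x
  have Gder: "((\<lambda>t. G j (x + t *\<^sub>R axis j 1)) has_real_derivative g j x) (at 0)" if x: "x \<in> ?B" for j x
  proof -
    note d = C2_on_derivative[OF u x, of j] C2_on_derivative[OF \<psi> x, of j]
    have "((\<lambda>t. X (x + t *\<^sub>R axis j 1)) has_real_derivative - (2 * x $ j)) (at 0)"
      unfolding X_def using DERIV_diff[OF DERIV_const[of 1] norm_sq_derivative[of x j]] by simp
    then have p: "((\<lambda>t. X (x + t *\<^sub>R axis j 1) powr (2 - n)) has_real_derivative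
        (2 - n) * X x powr (2 - n - 1) * - (2 * x $ j)) (at 0)"
      using DERIV_fun_powr[of "\<lambda>t. X (x + t *\<^sub>R axis j 1)" "- (2 * x $ j)" 0 "2 - n"] X[OF x] by simp
    have "g j x = (2 - n) * X x powr (2 - n - 1) * - (2 * x $ j) *
        (\<psi> (x + 0 *\<^sub>R axis j 1) * partial_deriv j u (x + 0 *\<^sub>R axis j 1)
         - u (x + 0 *\<^sub>R axis j 1) * partial_deriv j \<psi> (x + 0 *\<^sub>R axis j 1))
      + (partial_deriv j \<psi> x * partial_deriv j u (x + 0 *\<^sub>R axis j 1)
         + partial_deriv j (partial_deriv j u) x * \<psi> (x + 0 *\<^sub>R axis j 1)
         - (partial_deriv j u x * partial_deriv j \<psi> (x + 0 *\<^sub>R axis j 1)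
            + partial_deriv j (partial_deriv j \<psi>) x * u (x + 0 *\<^sub>R axis j 1)))
        * X (x + 0 *\<^sub>R axis j 1) powr (2 - n)"
      by (simp add: g_def algebra_simps)
    then show ?thesis
      unfolding G_def
      by (simp only: ) (intro DERIV_mult DERIV_diff p d)
  qed
  have Gc: "continuous_on ?B (G j)" and gc: "continuous_on ?B (g j)" for j
  proof -
    have "continuous_on ?B X" unfolding X_def by (intro continuous_intros)
    then have p: "continuous_on ?B (\<lambda>x. X x powr c)" for c
      using X by (intro continuous_on_powr continuous_intros) force+
    show "continuous_on ?B (G j)" "continuous_on ?B (g j)"
      unfolding G_def g_def
      by (intro continuous_intros p C2_on_continuous[OF u] C2_on_continuous[OF \<psi>])+
  qed
  \<comment> \<open>On \<open>S\<close>, the part of the ball beyond radius \<open>R\<close>, everything that involves \<open>\<psi>\<close> vanishes.\<close>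
  define S where "S = ?B \<inter> {x. norm x > R}"
  have S: "open S" unfolding S_def
    by (intro open_Int open_ball open_Collect_less continuous_intros)
  have \<psi>0: "\<psi> x = 0" "partial_deriv j \<psi> x = 0" "partial_deriv i (partial_deriv j \<psi>) x = 0" if "x \<in> S" for x i j
  proof -
    \<comment> \<open>The derivatives of \<open>\<psi>\<close> on \<open>S\<close> are those of the zero function.\<close>
    have z: "partial_deriv j (\<lambda>_. 0) y = 0" for j y by (simp add: partial_deriv_def)
    have a: "\<psi> y = 0" if "y \<in> S" for y using R that by (auto simp: S_def)
    have b: "partial_deriv j \<psi> y = 0" if "y \<in> S" for j y
      using partial_deriv_cong_open(1)[OF S that, of \<psi> "\<lambda>_. 0"] a z by simp
    show "\<psi> x = 0" "partial_deriv j \<psi> x = 0" "partial_deriv i (partial_deriv j \<psi>) x = 0"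
      using a b partial_deriv_cong_open(1)[OF S that, of "partial_deriv j \<psi>" "\<lambda>_. 0" i] that z by simp_all
  qed
  have G0: "G j x = 0" and g0: "g j x = 0" if "x \<in> S" for j x
    using \<psi>0[OF that] by (simp_all add: G_def g_def)
  have main: "integrable lborel (\<lambda>x. indicat_real ?B x * g j x) \<and> (\<integral>x. indicat_real ?B x * g j x \<partial>lborel) = 0" for j
  proof -
    define F where "F x = indicat_real ?B x * G j x" for x
    have Fnear: "F x = 0" if "norm x > R" for x
      using G0[of x j] that by (auto simp: F_def S_def indicator_def)
    have cb: "cball 0 R \<subseteq> ?B" using R by auto
    have bdd: "\<exists>M. \<forall>x. \<bar>indicat_real ?B x * v x\<bar> \<le> M"
      if v: "continuous_on ?B v" and v0: "\<And>x. x \<in> S \<Longrightarrow> v x = 0" for v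
    proof -
      have "compact (v ` cball 0 R)"
        by (intro compact_continuous_image continuous_on_subset[OF v cb]) auto
      then have "bounded (v ` cball 0 R)" by (rule compact_imp_bounded)
      then obtain M where M: "M > 0" "\<And>x. x \<in> cball 0 R \<Longrightarrow> \<bar>v x\<bar> \<le> M"
        by (auto simp: bounded_pos)
      have "\<bar>indicat_real ?B x * v x\<bar> \<le> M" for x
      proof (cases "norm x \<le> R")
        case True then show ?thesis using M(2)[of x] cb by (auto simp: indicator_def) 
      next
        case False then show ?thesis using M(1) v0[of x] by (auto simp: indicator_def S_def)
      qed
      then show ?thesis by blast
    qed
    obtain M where M: "\<And>x. \<bar>indicat_real ?B x * g j x\<bar> \<le> M" using bdd[OF gc g0] by blast
    obtain N where N: "\<And>x. \<bar>F x\<bar> \<le> N" using bdd[OF Gc G0] unfolding F_def by blast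
    have Fm: "F \<in> borel_measurable borel"
      using borel_measurable_continuous_on_indicator[OF _ Gc, of j] by (simp add: F_def[abs_def])
    have "((\<lambda>t. F (x + t *\<^sub>R axis j 1)) has_real_derivative indicat_real ?B x * g j x) (at 0)" for x
    proof (cases "x \<in> ?B")
      case True
      then show ?thesis
        using partial_deriv_cong_open(2)[of ?B x F "G j"] Gder[OF True] by (simp add: F_def)
    next
      case False
      define T where "T = {x::real^'n. norm x > R}"
      have "open T" unfolding T_def by (intro open_Collect_less continuous_intros)
      moreover have "x \<in> T" using False R by (auto simp: T_def)
      ultimately show ?thesis
        using partial_deriv_cong_open(2)[of T x F "\<lambda>_. 0" j 0] False Fnear by (simp add: T_def)
    qed
    from integral_partial_derivative_zero[OF this Fm N M Fnear]
    show ?thesis by blast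
  qed
  define Q where "Q x = (\<psi> x * Delta (n / 2 - 1) u x - u x * Delta (n / 2 - 1) \<psi> x) / X x ^ CARD('n)" for x
  have "(\<Sum>j\<in>UNIV. indicat_real ?B x * g j x) = 4 * (indicat_real ?B x * Q x)" for x
    using Laplacian_divergence_form[of x \<psi> u]
    by (cases "x \<in> ?B") (simp_all add: g_def Q_def X_def n_def)
  then have "(\<integral>x. 4 * (indicat_real ?B x * Q x) \<partial>lborel)
      = (\<integral>x. (\<Sum>j\<in>UNIV. indicat_real ?B x * g j x) \<partial>lborel)"
    by simp
  also have "\<dots> = (\<Sum>j\<in>UNIV. \<integral>x. indicat_real ?B x * g j x \<partial>lborel)"
    by (rule Bochner_Integration.integral_sum) (use main in blast)
  also have "\<dots> = 0"
    using main by simp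
  finally have "(\<integral>x. indicat_real ?B x * Q x \<partial>lborel) = 0"
    by simp
  then show ?thesis
    by (simp add: set_lebesgue_integral_def Q_def n_def X_def)
qed

section \<open>Hyperbolically radial functions\<close>

text \<open>This is \<open>sinh\<^sup>2 (d / 2)\<close> for the distance \<open>d\<close> of the metric \<open>2 |dx| / (1 - |x|\<^sup>2)\<close>.  It is
  rational, and unlike \<open>d\<close> it is smooth on the diagonal.\<close>
definition sinh_half_sq :: "'a::real_normed_vector \<Rightarrow> 'a \<Rightarrow> real" where
  "sinh_half_sq a x = (norm (x - a))\<^sup>2 / ((1 - (norm a)\<^sup>2) * (1 - (norm x)\<^sup>2))"

lemma sinh_half_sq_nonneg:
  "a \<in> ball 0 1 \<Longrightarrow> x \<in> ball 0 1 \<Longrightarrow> sinh_half_sq a x \<ge> 0"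
  using one_minus_norm_sq_pos[of a] one_minus_norm_sq_pos[of x] by (simp add: sinh_half_sq_def)

lemma continuous_on_sinh_half_sq:
  "a \<in> ball 0 1 \<Longrightarrow> continuous_on (ball 0 1) (sinh_half_sq a)"
  unfolding sinh_half_sq_def [abs_def]
  by (intro continuous_intros) (metis less_irrefl one_minus_norm_sq_pos mult_eq_0_iff)

definition sinh_half_sq_deriv :: "real ^ 'n \<Rightarrow> 'n \<Rightarrow> real ^ 'n \<Rightarrow> real" where
  "sinh_half_sq_deriv a j x = 2 / (1 - (norm a)\<^sup>2) *
     ((x $ j - a $ j) / (1 - (norm x)\<^sup>2) + (norm (x - a))\<^sup>2 * x $ j / (1 - (norm x)\<^sup>2)\<^sup>2)"

definition sinh_half_sq_deriv2 :: "real ^ 'n \<Rightarrow> 'n \<Rightarrow> 'n \<Rightarrow> real ^ 'n \<Rightarrow> real" where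
  "sinh_half_sq_deriv2 a i j x = 2 / (1 - (norm a)\<^sup>2) *
     (axis i 1 $ j / (1 - (norm x)\<^sup>2) + 2 * (x $ j - a $ j) * x $ i / (1 - (norm x)\<^sup>2)\<^sup>2
      + 2 * (x $ i - a $ i) * x $ j / (1 - (norm x)\<^sup>2)\<^sup>2
      + (norm (x - a))\<^sup>2 * axis i 1 $ j / (1 - (norm x)\<^sup>2)\<^sup>2
      + 4 * (norm (x - a))\<^sup>2 * x $ i * x $ j / (1 - (norm x)\<^sup>2) ^ 3)"

lemma sinh_half_sq_has_deriv:
  fixes x a :: "real ^ 'n"
  assumes x: "x \<in> ball 0 1" and a: "a \<in> ball 0 1"
  shows "((\<lambda>t. sinh_half_sq a (x + t *\<^sub>R axis j 1)) has_real_derivative sinh_half_sq_deriv a j x) (at 0)"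
    and "((\<lambda>t. sinh_half_sq_deriv a j (x + t *\<^sub>R axis i 1)) has_real_derivative sinh_half_sq_deriv2 a i j x) (at 0)"
proof -
  define A where "A = 1 - (norm a)\<^sup>2"
  define X where "X t i = 1 - (norm (x + t *\<^sub>R axis i 1))\<^sup>2" for t i
  define N where "N t i = (norm (x + t *\<^sub>R axis i 1 - a))\<^sup>2" for t i
  define Y where "Y = 1 - (norm x)\<^sup>2"
  have A: "A > 0" and X0: "Y > 0" using one_minus_norm_sq_pos a x by (auto simp: A_def Y_def)
  have Xat: "X 0 i = Y" and Nat: "N 0 i = (norm (x - a))\<^sup>2" for i by (simp_all add: X_def N_def Y_def)
  have dX: "((\<lambda>t. X t i) has_real_derivative - (2 * x $ i)) (at 0)" for i
    unfolding X_def using DERIV_diff[OF DERIV_const[of 1] norm_sq_derivative[of x i]] by simp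
  have dN: "((\<lambda>t. N t i) has_real_derivative 2 * (x $ i - a $ i)) (at 0)" for i
    unfolding N_def using norm_sq_derivative[of "x - a" i] by (simp add: algebra_simps)
  have dc: "((\<lambda>t. (x + t *\<^sub>R axis i 1) $ j) has_real_derivative axis i 1 $ j) (at 0)" for i j
    by (auto intro!: derivative_eq_intros)
  have X0i: "X 0 i \<noteq> 0" for i using X0 by (simp add: Xat)
  show "((\<lambda>t. sinh_half_sq a (x + t *\<^sub>R axis j 1)) has_real_derivative sinh_half_sq_deriv a j x) (at 0)"
  proof -
    have "((\<lambda>t. N t j / (A * X t j)) has_real_derivative sinh_half_sq_deriv a j x) (at 0)"
      by (rule derivative_eq_intros dN dX refl | use A X0i in force)+
        (use A X0 in \<open>simp add: sinh_half_sq_deriv_def Xat Nat A_def[symmetric] Y_def[symmetric], simp add: field_simps power2_eq_square\<close>)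
    then show ?thesis by (simp add: sinh_half_sq_def N_def X_def A_def)
  qed
  show "((\<lambda>t. sinh_half_sq_deriv a j (x + t *\<^sub>R axis i 1)) has_real_derivative sinh_half_sq_deriv2 a i j x) (at 0)"
  proof -
    have "((\<lambda>t. 2 / A * (((x + t *\<^sub>R axis i 1) $ j - a $ j) / X t i + N t i * (x + t *\<^sub>R axis i 1) $ j / (X t i)\<^sup>2))
       has_real_derivative sinh_half_sq_deriv2 a i j x) (at 0)"
      by (rule derivative_eq_intros dN dX dc refl | use A X0i in force)+
        (use A X0 in \<open>simp add: sinh_half_sq_deriv2_def Xat Nat A_def[symmetric] Y_def[symmetric], simp add: field_simps eval_nat_numeral\<close>)
    then show ?thesis by (simp add: sinh_half_sq_deriv_def N_def X_def A_def)
  qed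
qed

text \<open>In polar coordinates around \<open>a\<close> these are \<open>|\<nabla>s|\<^sup>2 = s (1 + s)\<close> and \<open>\<Delta>s = (n / 2)(1 + 2 s)\<close> for the
  hyperbolic gradient and Laplacian.  In Euclidean coordinates they
  follow from the relation \<open>2 x \<bullet> (x - a) = |x - a|\<^sup>2 + |x|\<^sup>2 - |a|\<^sup>2\<close>, which removes the
  dependence on the direction of \<open>a\<close>.\<close>
lemma sinh_half_sq_sums:
  fixes x a :: "real ^ 'n"
  assumes x: "x \<in> ball 0 1" and a: "a \<in> ball 0 1"
  defines "n \<equiv> real CARD('n)" and "X \<equiv> 1 - (norm x)\<^sup>2" and "s \<equiv> sinh_half_sq a x"
  shows "X\<^sup>2 / 4 * (\<Sum>j\<in>UNIV. (sinh_half_sq_deriv a j x)\<^sup>2) = s * (1 + s)"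
    and "X * (X / 4 * (\<Sum>j\<in>UNIV. sinh_half_sq_deriv2 a j j x)
        + (n / 2 - 1) * (\<Sum>j\<in>UNIV. x $ j * sinh_half_sq_deriv a j x)) = n / 2 * (1 + 2 * s)"
proof -
  define A where "A = 1 - (norm a)\<^sup>2"
  define N where "N = (norm (x - a))\<^sup>2"
  define C where "C = (\<Sum>j\<in>UNIV. x $ j * (x $ j - a $ j))"
  have A: "A > 0" and X: "X > 0" using one_minus_norm_sq_pos a x by (auto simp: A_def X_def)
  have s: "s = N / (A * X)" by (simp add: s_def sinh_half_sq_def N_def A_def X_def)
  have xx: "(\<Sum>j\<in>UNIV. x $ j * x $ j) = 1 - X"
    by (simp add: X_def power2_norm_eq_inner inner_vec_def)
  have NN: "(\<Sum>j\<in>UNIV. (x $ j - a $ j) * (x $ j - a $ j)) = N"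
    by (simp add: N_def power2_norm_eq_inner inner_vec_def)
  \<comment> \<open>The relation that makes both sums functions of \<open>s\<close> alone.\<close>
  have rel: "2 * C = N + A - X"
    by (simp add: C_def N_def A_def X_def power2_norm_eq_inner inner_vec_def sum_subtractf[symmetric]
      sum.distrib[symmetric] sum_distrib_left algebra_simps)
  then have C: "C = (N + A - X) / 2" by simp
  have d: "sinh_half_sq_deriv a j x = 2 / A * ((x $ j - a $ j) / X + N * x $ j / X\<^sup>2)" for j
    by (simp add: sinh_half_sq_deriv_def A_def X_def N_def)
  have "(\<Sum>j\<in>UNIV. (sinh_half_sq_deriv a j x)\<^sup>2) =
     (\<Sum>j\<in>UNIV. 4 / A\<^sup>2 * (1 / X\<^sup>2 * ((x $ j - a $ j) * (x $ j - a $ j)) + 2 * N / X ^ 3 * (x $ j * (x $ j - a $ j))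
        + N\<^sup>2 / X ^ 4 * (x $ j * x $ j)))"
    unfolding d using A X by (intro sum.cong refl) (simp add: field_simps power2_eq_square power3_eq_cube power4_eq_xxxx)
  also have "\<dots> = 4 / A\<^sup>2 * (1 / X\<^sup>2 * N + 2 * N / X ^ 3 * C + N\<^sup>2 / X ^ 4 * (1 - X))"
    unfolding sum_distrib_left[symmetric] sum.distrib xx NN C_def[symmetric] ..
  also have "X\<^sup>2 / 4 * \<dots> = s * (1 + s)"
  proof -
    have e: "1 / X\<^sup>2 * N + 2 * N / X ^ 3 * C + N\<^sup>2 / X ^ 4 * (1 - X) = N * (A * X + N) / X ^ 4"
      unfolding C using X by (simp add: field_simps eval_nat_numeral)
    show ?thesis
      unfolding e s using A X by (simp add: field_simps eval_nat_numeral)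
  qed
  finally show "X\<^sup>2 / 4 * (\<Sum>j\<in>UNIV. (sinh_half_sq_deriv a j x)\<^sup>2) = s * (1 + s)" .
  have "(\<Sum>j\<in>UNIV. sinh_half_sq_deriv2 a j j x) =
     (\<Sum>j\<in>UNIV. 2 / A * ((1 / X + N / X\<^sup>2) * 1 + 4 / X\<^sup>2 * (x $ j * (x $ j - a $ j)) + 4 * N / X ^ 3 * (x $ j * x $ j)))"
    unfolding sinh_half_sq_deriv2_def A_def[symmetric] X_def[symmetric] N_def[symmetric]
    using A X by (intro sum.cong refl) (simp add: axis_def field_simps power2_eq_square power3_eq_cube)
  also have "\<dots> = 2 / A * ((1 / X + N / X\<^sup>2) * n + 4 / X\<^sup>2 * C + 4 * N / X ^ 3 * (1 - X))"
    unfolding sum_distrib_left[symmetric] sum.distrib xx NN C_def[symmetric] by (simp add: n_def)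
  finally have S2: "(\<Sum>j\<in>UNIV. sinh_half_sq_deriv2 a j j x) = \<dots>" .
  have "(\<Sum>j\<in>UNIV. x $ j * sinh_half_sq_deriv a j x) =
     (\<Sum>j\<in>UNIV. 2 / A * (1 / X * (x $ j * (x $ j - a $ j)) + N / X\<^sup>2 * (x $ j * x $ j)))"
    unfolding d using A X by (intro sum.cong refl) (simp add: field_simps power2_eq_square)
  also have "\<dots> = 2 / A * (1 / X * C + N / X\<^sup>2 * (1 - X))"
    unfolding sum_distrib_left[symmetric] sum.distrib xx NN C_def[symmetric] ..
  finally have S1: "(\<Sum>j\<in>UNIV. x $ j * sinh_half_sq_deriv a j x) = \<dots>" .
  show "X * (X / 4 * (\<Sum>j\<in>UNIV. sinh_half_sq_deriv2 a j j x)
        + (n / 2 - 1) * (\<Sum>j\<in>UNIV. x $ j * sinh_half_sq_deriv a j x)) = n / 2 * (1 + 2 * s)"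
    unfolding S1 S2 s C using A X by (simp add: field_simps power2_eq_square power3_eq_cube)
qed

lemma Delta_radial:
  fixes a :: "real ^ 'n"
  assumes a: "a \<in> ball 0 1"
    and f1: "\<And>s. s > -1 \<Longrightarrow> (f has_real_derivative f1 s) (at s)"
    and f2: "\<And>s. s > -1 \<Longrightarrow> (f1 has_real_derivative f2 s) (at s)"
    and cont: "continuous_on {-1<..} f2"
  shows "C2_on (ball 0 1) (\<lambda>x. f (sinh_half_sq a x))"
    and "\<And>x. x \<in> ball 0 1 \<Longrightarrow> Delta (real CARD('n) / 2 - 1) (\<lambda>x. f (sinh_half_sq a x)) x =
       sinh_half_sq a x * (1 + sinh_half_sq a x) * f2 (sinh_half_sq a x)
       + real CARD('n) / 2 * (1 + 2 * sinh_half_sq a x) * f1 (sinh_half_sq a x)"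
proof -
  let ?B = "ball 0 1 :: (real ^ 'n) set" and ?s = "sinh_half_sq a"
  let ?g = "\<lambda>j x. f1 (?s x) * sinh_half_sq_deriv a j x"
  let ?h = "\<lambda>i j x. f2 (?s x) * sinh_half_sq_deriv a i x * sinh_half_sq_deriv a j x
      + f1 (?s x) * sinh_half_sq_deriv2 a i j x"
  have range: "?s x > -1" if "x \<in> ?B" for x
    using sinh_half_sq_nonneg[OF a that] by simp
  have comp: "continuous_on ?B (\<lambda>x. k (?s x))" if "continuous_on {-1<..} k" for k :: "real \<Rightarrow> real"
    by (rule continuous_on_compose2[OF that continuous_on_sinh_half_sq[OF a]]) (use range in auto)
  have X: "1 - (norm x)\<^sup>2 \<noteq> 0" if "x \<in> ?B" for x :: "real ^ 'n"
    using one_minus_norm_sq_pos[OF that] by simp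
  have cf: "continuous_on {-1<..} f" "continuous_on {-1<..} f1"
    using DERIV_continuous_on f1 f2 by (metis greaterThan_iff has_field_derivative_at_within)+
  have cd: "continuous_on ?B (sinh_half_sq_deriv a j)" "continuous_on ?B (sinh_half_sq_deriv2 a i j)" for i j
    unfolding sinh_half_sq_deriv_def[abs_def] sinh_half_sq_deriv2_def[abs_def]
    by (intro continuous_intros; use X one_minus_norm_sq_pos[OF a] in force)+
  have c: "continuous_on ?B (\<lambda>x. f (?s x))" "continuous_on ?B (?g j)" "continuous_on ?B (?h i j)" for i j
    by (intro continuous_intros comp cf cont cd)+
  have g: "((\<lambda>t. f (?s (x + t *\<^sub>R axis j 1))) has_real_derivative ?g j x) (at 0)" if "x \<in> ?B" for j x
    using DERIV_chain2[of f "f1 (?s x)" "\<lambda>t. ?s (x + t *\<^sub>R axis j 1)" 0, OF _ sinh_half_sq_has_deriv(1)[OF that a]]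
      f1[OF range[OF that]] by simp
  have h: "((\<lambda>t. ?g j (x + t *\<^sub>R axis i 1)) has_real_derivative ?h i j x) (at 0)" if "x \<in> ?B" for i j x
  proof -
    have "((\<lambda>t. f1 (?s (x + t *\<^sub>R axis i 1))) has_real_derivative f2 (?s x) * sinh_half_sq_deriv a i x) (at 0)"
      using DERIV_chain2[of f1 "f2 (?s x)" "\<lambda>t. ?s (x + t *\<^sub>R axis i 1)" 0, OF _ sinh_half_sq_has_deriv(1)[OF that a]]
        f2[OF range[OF that]] by simp
    from DERIV_mult[OF this sinh_half_sq_has_deriv(2)[OF that a, of j i]] show ?thesis
      by (simp add: algebra_simps)
  qed
  have C2: "C2_on ?B (\<lambda>x. f (?s x))" "\<And>j x. x \<in> ?B \<Longrightarrow> partial_deriv j (\<lambda>x. f (?s x)) x = ?g j x"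
    "\<And>i j x. x \<in> ?B \<Longrightarrow> partial_deriv i (partial_deriv j (\<lambda>x. f (?s x))) x = ?h i j x"
    using C2_onI[of ?B "\<lambda>x. f (?s x)" ?g ?h] c g h by blast+
  show "C2_on ?B (\<lambda>x. f (?s x))" by (rule C2(1))
  show "Delta (real CARD('n) / 2 - 1) (\<lambda>x. f (?s x)) x =
       ?s x * (1 + ?s x) * f2 (?s x) + real CARD('n) / 2 * (1 + 2 * ?s x) * f1 (?s x)" if x: "x \<in> ?B" for x
  proof -
    define X where "X = 1 - (norm x)\<^sup>2"
    define n where "n = real CARD('n)"
    have "Delta (n / 2 - 1) (\<lambda>x. f (?s x)) x = X * (X / 4 * (\<Sum>j\<in>UNIV. ?h j j x) + (n / 2 - 1) * (\<Sum>j\<in>UNIV. x $ j * ?g j x))"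
      unfolding Delta_def by (simp add: C2(2,3)[OF x] X_def n_def)
    also have "\<dots> = f2 (?s x) * (X\<^sup>2 / 4 * (\<Sum>j\<in>UNIV. (sinh_half_sq_deriv a j x)\<^sup>2))
       + f1 (?s x) * (X * (X / 4 * (\<Sum>j\<in>UNIV. sinh_half_sq_deriv2 a j j x)
        + (n / 2 - 1) * (\<Sum>j\<in>UNIV. x $ j * sinh_half_sq_deriv a j x)))"
      by (simp add: sum.distrib sum_distrib_left power2_eq_square algebra_simps)
    also have "\<dots> = f2 (?s x) * (?s x * (1 + ?s x)) + f1 (?s x) * (n / 2 * (1 + 2 * ?s x))"
      unfolding X_def n_def sinh_half_sq_sums[OF x a] ..
    finally show ?thesis by (simp add: n_def algebra_simps)
  qed
qed

section \<open>Radial averages\<close>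

definition annular_weight :: "real \<Rightarrow> real \<Rightarrow> (real \<Rightarrow> real) \<Rightarrow> bool" where
  "annular_weight l b w \<longleftrightarrow> 0 < l \<and> l < b \<and> continuous_on UNIV w \<and> (\<forall>s. s \<notin> {l..b} \<longrightarrow> w s = 0)"

text \<open>In the coordinate \<open>s = sinh\<^sup>2 (d / 2)\<close>, the hyperbolic volume of a shell around a point is
  a constant times \<open>(s (1 + s))\<^sup>n\<^sup>/\<^sup>2\<^sup>-\<^sup>1 ds\<close>.\<close>
definition radial_mass :: "real \<Rightarrow> (real \<Rightarrow> real) \<Rightarrow> real" where
  "radial_mass n w = integral {0..} (\<lambda>s. w s * (s * (1 + s)) powr (n / 2 - 1))"

text \<open>Integration is against the hyperbolic volume; its constant factor \<open>2\<^sup>n\<close> is dropped.\<close>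
definition radial_integral :: "(real ^ 'n \<Rightarrow> real) \<Rightarrow> (real \<Rightarrow> real) \<Rightarrow> real ^ 'n \<Rightarrow> real" where
  "radial_integral u w a =
     (LINT x:ball 0 1|lborel. u x * w (sinh_half_sq a x) / (1 - (norm x)\<^sup>2) ^ CARD('n))"

lemma annular_weight_mono:
  assumes "annular_weight l b w" "0 < l'" "l' \<le> l" "b \<le> b'"
  shows "annular_weight l' b' w"
  using assms by (auto simp: annular_weight_def)

text \<open>Powers of \<open>s (1 + s)\<close> can be singular at \<open>s = 0\<close> and \<open>s = -1\<close>; the weights cancel this, as they
  vanish to the left of some \<open>l > 0\<close>.\<close>
lemma continuous_on_vanishing_left:
  fixes k :: "real \<Rightarrow> real"
  assumes "0 < l" "continuous_on {0<..} k" "\<And>s. s < l \<Longrightarrow> k s = 0"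
  shows "continuous_on UNIV k"
proof -
  have "continuous_on {..<l} k"
    using assms(3) continuous_on_cong[of "{..<l}" "{..<l}" k "\<lambda>_. 0"] by simp
  then have "continuous_on ({0<..} \<union> {..<l}) k"
    using assms(2) by (intro continuous_on_open_Un) auto
  moreover have "{0<..} \<union> {..<l} = UNIV" using assms(1) by auto
  ultimately show ?thesis by simp
qed

lemma continuous_on_mass_integrand:
  assumes "annular_weight l b w"
  shows "continuous_on UNIV (\<lambda>s. w s * (s * (1 + s)) powr c)"
proof (rule continuous_on_vanishing_left[of l])
  show "continuous_on {0<..} (\<lambda>s. w s * (s * (1 + s)) powr c)"
    using assms unfolding annular_weight_def
    by (intro continuous_intros) (auto intro: continuous_on_subset)
qed (use assms in \<open>auto simp: annular_weight_def\<close>)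

lemma radial_mass_eq:
  assumes "annular_weight l b w"
  shows "radial_mass n w = integral {l..b} (\<lambda>s. w s * (s * (1 + s)) powr (n / 2 - 1))"
proof -
  let ?f = "\<lambda>s. w s * (s * (1 + s)) powr (n / 2 - 1)"
  have "?f integrable_on {l..b}"
    by (intro integrable_continuous_real continuous_on_subset[OF continuous_on_mass_integrand[OF assms]]) simp
  then have "(?f has_integral integral {l..b} ?f) {l..b}" by (rule integrable_integral)
  then have "(?f has_integral integral {l..b} ?f) {0..}"
    by (rule has_integral_on_superset) (use assms in \<open>auto simp: annular_weight_def\<close>)
  then show ?thesis unfolding radial_mass_def by (rule integral_unique)
qed

lemma antiderivative_integral:
  fixes g :: "real \<Rightarrow> real"
  assumes "continuous_on UNIV g" "s > c"
  shows "((\<lambda>s. integral {c..s} g) has_real_derivative g s) (at s)"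
proof -
  have "((\<lambda>x. integral {c..x} g) has_real_derivative g s) (at s within {c..s+1})"
    by (rule integral_has_real_derivative) (use assms in \<open>auto intro: continuous_on_subset\<close>)
  moreover have "at s within {c..s+1} = at s"
    using assms(2) by (intro at_within_interior) simp
  ultimately show ?thesis by simp
qed

text \<open>In divergence form the radial operator maps \<open>f\<close> to \<open>(s (1 + s))\<^sup>1\<^sup>-\<^sup>n\<^sup>/\<^sup>2 ((s (1 + s))\<^sup>n\<^sup>/\<^sup>2 f')'\<close>, so the equation
  is solved by two integrations.  The first one, \<open>\<Phi>\<close>, vanishes beyond \<open>b\<close> exactly because
  the total mass of \<open>w\<close> is zero; it also vanishes before \<open>l\<close>, which keeps \<open>f\<close> smooth at the centre.  The
  interval starts at \<open>-1\<close> so that \<open>s = 0\<close>, the value at the centre, is an interior point.\<close>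
lemma radial_potential_exists:
  assumes w: "annular_weight l b w" and mass0: "radial_mass n w = 0"
  obtains f f1 f2 :: "real \<Rightarrow> real" where
    "\<And>s. s > -1 \<Longrightarrow> (f has_real_derivative f1 s) (at s)"
    "\<And>s. s > -1 \<Longrightarrow> (f1 has_real_derivative f2 s) (at s)"
    "continuous_on UNIV f2"
    "\<And>s. s \<ge> b \<Longrightarrow> f s = 0"
    "\<And>s. s \<ge> 0 \<Longrightarrow> s * (1 + s) * f2 s + n / 2 * (1 + 2 * s) * f1 s = w s"
proof -
  define g where "g s = w s * (s * (1 + s)) powr (n / 2 - 1)" for s
  define \<Phi> where "\<Phi> s = integral {-1..s} g" for s
  have w0: "w s = 0" if "s \<notin> {l..b}" for s
    using w that by (auto simp: annular_weight_def)
  have l: "0 < l" "l < b" using w by (auto simp: annular_weight_def)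
  have g0: "g s = 0" if "s \<notin> {l..b}" for s using w0[OF that] by (simp add: g_def)
  have gc: "continuous_on UNIV g"
    unfolding g_def by (rule continuous_on_mass_integrand[OF w])
  have gi: "g integrable_on {c..d}" for c d
    by (intro integrable_continuous_real continuous_on_subset[OF gc]) simp
  have d\<Phi>: "(\<Phi> has_real_derivative g s) (at s)" if "s > -1" for s
    unfolding \<Phi>_def by (rule antiderivative_integral[OF gc that])
  have \<Phi>l: "\<Phi> s = 0" if "s < l" for s
  proof -
    have "\<Phi> s = integral {-1..s} (\<lambda>_. 0)"
      unfolding \<Phi>_def by (rule integral_cong) (use that g0 in auto)
    then show ?thesis by simp
  qed
  have zero_right: "integral {b..s} h = 0" if "\<And>s. s > b \<Longrightarrow> h s = (0::real)" for s h
  proof -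
    have "integral {b..s} h = integral {b..s} (\<lambda>_. 0)"
      by (rule integral_spike[of "{b}"]) (use that in auto)
    then show ?thesis by simp
  qed
  have \<Phi>b: "\<Phi> s = 0" if "s \<ge> b" for s
  proof -
    have "\<Phi> s = integral {-1..l} g + integral {l..b} g + integral {b..s} g"
      unfolding \<Phi>_def using l that gi
      by (simp add: Henstock_Kurzweil_Integration.integral_combine)
    also have "integral {-1..l} g = integral {-1..l} (\<lambda>_. 0)"
      by (rule integral_spike[of "{l}"]) (use g0 in auto)
    also have "integral {l..b} g = 0"
      using mass0 unfolding radial_mass_eq[OF w] g_def .
    also have "integral {b..s} g = 0" by (rule zero_right) (use g0 in auto)
    finally show ?thesis by simp
  qed
  \<comment> \<open>First integral of the equation, and its derivative computed by the product rule.\<close>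
  define f1 where "f1 s = (s * (1 + s)) powr (- n / 2) * \<Phi> s" for s
  define f2 where "f2 s = - n / 2 * (s * (1 + s)) powr (- n / 2 - 1) * (1 + 2 * s) * \<Phi> s
      + (s * (1 + s)) powr (- n / 2) * g s" for s
  have \<Phi>c: "continuous_on {0<..} \<Phi>"
    by (rule DERIV_continuous_on[of _ _ g]) (use d\<Phi> in \<open>auto intro: has_field_derivative_at_within\<close>)
  have p: "continuous_on {0<..} (\<lambda>s::real. (s * (1 + s)) powr c)" for c
    by (intro continuous_intros) auto
  have f1c: "continuous_on UNIV f1"
  proof (rule continuous_on_vanishing_left[OF l(1)])
    show "continuous_on {0<..} f1" unfolding f1_def by (intro continuous_intros p \<Phi>c)
  qed (use \<Phi>l in \<open>auto simp: f1_def\<close>)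
  have f2c: "continuous_on UNIV f2"
  proof (rule continuous_on_vanishing_left[OF l(1)])
    show "continuous_on {0<..} f2" unfolding f2_def
      by (intro continuous_intros p \<Phi>c continuous_on_subset[OF gc]) auto
  qed (use \<Phi>l g0 in \<open>auto simp: f2_def\<close>)
  have df1: "(f1 has_real_derivative f2 s) (at s)" for s
  proof (cases "s > 0")
    case True
    have "((\<lambda>s. s * (1 + s)) has_real_derivative 1 + 2 * s) (at s)"
      by (auto intro!: derivative_eq_intros)
    then have "((\<lambda>s. (s * (1 + s)) powr (- n / 2)) has_real_derivative
        - n / 2 * (s * (1 + s)) powr (- n / 2 - 1) * (1 + 2 * s)) (at s)"
      using DERIV_fun_powr[of "\<lambda>s. s * (1 + s)" "1 + 2 * s" s "- n / 2"] True by simp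
    from DERIV_mult[OF this d\<Phi>[of s]] True show ?thesis
      unfolding f1_def f2_def by (simp add: algebra_simps)
  next
    case False
    then have s: "s < l" using l by simp
    have "\<forall>\<^sub>F r in nhds s. r < l" using s by (intro eventually_nhds_in_open[of "{..<l}", simplified]) auto
    then have "\<forall>\<^sub>F r in nhds s. f1 r = 0"
      by eventually_elim (simp add: f1_def \<Phi>l)
    moreover have "f2 s = 0" using s by (simp add: f2_def \<Phi>l g0)
    ultimately show ?thesis using DERIV_cong_ev[OF refl, of f1 "\<lambda>_. 0" s "f2 s" 0] by simp
  qed
  define f where "f s = integral {-1..s} f1 - integral {-1..b} f1" for s
  show ?thesis
  proof (rule that[of f f1 f2])
    show "(f has_real_derivative f1 s) (at s)" if "s > -1" for s
      unfolding f_def using DERIV_diff[OF antiderivative_integral[OF f1c that] DERIV_const] by simp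
    show "f s = 0" if "s \<ge> b" for s
    proof -
      have "integral {-1..s} f1 = integral {-1..b} f1 + integral {b..s} f1"
        by (rule Henstock_Kurzweil_Integration.integral_combine[symmetric])
          (use l that in \<open>auto intro!: integrable_continuous_real continuous_on_subset[OF f1c]\<close>)
      moreover have "integral {b..s} f1 = 0" by (rule zero_right) (simp add: f1_def \<Phi>b)
      ultimately show ?thesis by (simp add: f_def)
    qed
    show "s * (1 + s) * f2 s + n / 2 * (1 + 2 * s) * f1 s = w s" if "s \<ge> 0" for s
    proof (cases "s < l")
      case True
      then show ?thesis using w0 by (simp add: f1_def f2_def \<Phi>l g0)
    next
      case False
      then have q: "s * (1 + s) > 0" using l by simp
      have e: "(s * (1 + s)) powr (- n / 2 - 1) = (s * (1 + s)) powr (- n / 2) / (s * (1 + s))"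
        using q by (simp add: powr_diff)
      have "(s * (1 + s)) powr (- n / 2) * (s * (1 + s)) powr (n / 2 - 1) = (s * (1 + s)) powr (-1)"
        by (simp add: powr_add[symmetric])
      also have "\<dots> = 1 / (s * (1 + s))" using q by (subst powr_minus_divide) simp
      finally have "(s * (1 + s)) * ((s * (1 + s)) powr (- n / 2) * g s) = w s"
        using q by (simp add: g_def field_simps)
      moreover have "s * (1 + s) * (- n / 2 * (s * (1 + s)) powr (- n / 2 - 1) * (1 + 2 * s) * \<Phi> s) =
         - (n / 2 * (1 + 2 * s) * f1 s)"
        unfolding e f1_def using q by (simp add: field_simps)
      ultimately show ?thesis
        by (simp only: f2_def ring_distribs)
    qed
  qed (use df1 f2c in auto)
qed

text \<open>Hyperbolic balls are relatively compact in the unit ball, so a radial weight of bounded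
  support vanishes near the unit sphere.\<close>
lemma sinh_half_sq_tends_to_infinity:
  fixes a :: "'a::real_normed_vector"
  assumes a: "a \<in> ball 0 1"
  obtains R where "R < 1" "\<And>x. x \<in> ball 0 1 \<Longrightarrow> norm x > R \<Longrightarrow> sinh_half_sq a x > b"
proof -
  define A d B where "A = 1 - (norm a)\<^sup>2" and "d = 1 - norm a" and "B = \<bar>b\<bar> + 1"
  have pos: "A > 0" "d > 0" "B > 0" using a one_minus_norm_sq_pos[OF a] by (auto simp: A_def d_def B_def)
  \<comment> \<open>Beyond the first radius \<open>|x - a|\<close> is at least \<open>d / 2\<close>; beyond the second \<open>1 - |x|\<^sup>2\<close> is small enough.\<close>
  define R where "R = max ((1 + norm a) / 2) (1 - d\<^sup>2 / (8 * A * B))"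
  have "R < 1" using pos a by (simp add: R_def)
  moreover have "sinh_half_sq a x > b" if x: "x \<in> ball 0 1" "norm x > R" for x
  proof -
    define X where "X = 1 - (norm x)\<^sup>2"
    have X: "X > 0" using one_minus_norm_sq_pos[OF x(1)] by (simp add: X_def)
    have "norm x - norm a \<le> norm (x - a)" by (rule norm_triangle_ineq2)
    then have "d / 2 < norm (x - a)" using x(2) by (simp add: R_def d_def field_simps)
    then have N: "d\<^sup>2 / 4 < (norm (x - a))\<^sup>2"
      using pos power_strict_mono[of "d / 2" "norm (x - a)" 2] by (simp add: power_divide)
    have "X = (1 - norm x) * (1 + norm x)" by (simp add: X_def power2_eq_square algebra_simps)
    also have "\<dots> \<le> (1 - norm x) * 2" using x(1) by (intro mult_left_mono) auto
    also have "\<dots> < d\<^sup>2 / (8 * A * B) * 2" using x(2) by (simp add: R_def)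
    finally have "B * (A * X) < d\<^sup>2 / 4" using pos by (simp add: field_simps)
    also note N
    finally have "B < (norm (x - a))\<^sup>2 / (A * X)" using pos X by (simp add: field_simps)
    then show ?thesis by (simp add: sinh_half_sq_def A_def X_def B_def)
  qed
  ultimately show ?thesis using that by blast
qed

lemma radial_integrand_integrable:
  fixes u :: "real ^ 'n \<Rightarrow> real"
  assumes u: "continuous_on (ball 0 1) u" and a: "a \<in> ball 0 1" and w: "annular_weight l b w"
  shows "set_integrable lborel (ball 0 1) (\<lambda>x. u x * w (sinh_half_sq a x) / (1 - (norm x)\<^sup>2) ^ CARD('n))"
proof -
  let ?f = "\<lambda>x. u x * w (sinh_half_sq a x) / (1 - (norm x)\<^sup>2) ^ CARD('n)"
  obtain R where R: "R < 1" "\<And>x. x \<in> ball 0 1 \<Longrightarrow> norm x > R \<Longrightarrow> sinh_half_sq a x > b"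
    using sinh_half_sq_tends_to_infinity[OF a] by metis
  have "continuous_on (ball 0 1) (\<lambda>x. w (sinh_half_sq a x))"
    by (rule continuous_on_compose2[of UNIV w]) (use w continuous_on_sinh_half_sq[OF a] in \<open>auto simp: annular_weight_def\<close>)
  moreover have "1 - (norm x)\<^sup>2 \<noteq> 0" if "x \<in> ball 0 1" for x :: "real ^ 'n"
    using one_minus_norm_sq_pos[OF that] by simp
  ultimately have "continuous_on (ball 0 1) ?f"
    by (intro continuous_intros u) auto
  then have "continuous_on (cball 0 R) ?f"
    by (rule continuous_on_subset) (use R in auto)
  from borel_integrable_compact[OF compact_cball this]
  have "integrable lborel (\<lambda>x. indicat_real (cball 0 R) x *\<^sub>R ?f x)"
    by (simp add: indicator_def if_distrib cong: if_cong)
  also have "(\<lambda>x. indicat_real (cball 0 R) x *\<^sub>R ?f x) = (\<lambda>x. indicat_real (ball 0 1) x *\<^sub>R ?f x)"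
  proof
    fix x
    have "?f x = 0" if "x \<in> ball 0 1" "norm x > R"
      using R(2)[OF that] w by (simp add: annular_weight_def)
    then show "indicat_real (cball 0 R) x *\<^sub>R ?f x = indicat_real (ball 0 1) x *\<^sub>R ?f x"
      using R(1) by (auto simp: indicator_def)
  qed
  finally show ?thesis by (simp add: set_integrable_def)
qed

text \<open>Green's identity, applied to the potential of the weight.\<close>
lemma radial_integral_zero:
  fixes u :: "real ^ 'n \<Rightarrow> real"
  assumes u: "Delta_solution (real CARD('n) / 2 - 1) u" and a: "a \<in> ball 0 1"
    and w: "annular_weight l b w" and mass0: "radial_mass (real CARD('n)) w = 0"
  shows "radial_integral u w a = 0"
proof -
  obtain f f1 f2 where f:
    "\<And>s. s > -1 \<Longrightarrow> (f has_real_derivative f1 s) (at s)"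
    "\<And>s. s > -1 \<Longrightarrow> (f1 has_real_derivative f2 s) (at s)"
    "continuous_on UNIV f2"
    "\<And>s. s \<ge> b \<Longrightarrow> f s = 0"
    "\<And>s. s \<ge> 0 \<Longrightarrow> s * (1 + s) * f2 s + real CARD('n) / 2 * (1 + 2 * s) * f1 s = w s"
    using radial_potential_exists[OF w mass0] by metis
  obtain R where R: "R < 1" "\<And>x. x \<in> ball 0 1 \<Longrightarrow> norm x > R \<Longrightarrow> sinh_half_sq a x > b"
    using sinh_half_sq_tends_to_infinity[OF a] by metis
  let ?\<psi> = "\<lambda>x. f (sinh_half_sq a x)"
  have cf2: "continuous_on {-1<..} f2" using f(3) by (rule continuous_on_subset) simp
  have \<psi>: "C2_on (ball 0 1) ?\<psi>" "\<And>x. x \<in> ball 0 1 \<Longrightarrow> Delta (real CARD('n) / 2 - 1) ?\<psi> x =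
       sinh_half_sq a x * (1 + sinh_half_sq a x) * f2 (sinh_half_sq a x)
       + real CARD('n) / 2 * (1 + 2 * sinh_half_sq a x) * f1 (sinh_half_sq a x)"
    using Delta_radial[of a f f1 f2] a f(1,2) cf2 by blast+
  have D: "Delta (real CARD('n) / 2 - 1) ?\<psi> x = w (sinh_half_sq a x)" if "x \<in> ball 0 1" for x
    using \<psi>(2)[OF that] f(5)[OF sinh_half_sq_nonneg[OF a that]] by simp
  have "(LINT x:ball 0 1|lborel. (?\<psi> x * Delta (real CARD('n) / 2 - 1) u x
      - u x * Delta (real CARD('n) / 2 - 1) ?\<psi> x) / (1 - (norm x)\<^sup>2) ^ CARD('n)) = 0"
    using u by (intro Green_identity[OF _ \<psi>(1) R(1)])
      (auto simp: Delta_solution_def intro!: f(4) less_imp_le R(2))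
  moreover have "(LINT x:ball 0 1|lborel. (?\<psi> x * Delta (real CARD('n) / 2 - 1) u x
      - u x * Delta (real CARD('n) / 2 - 1) ?\<psi> x) / (1 - (norm x)\<^sup>2) ^ CARD('n))
     = (LINT x:ball 0 1|lborel. - (u x * w (sinh_half_sq a x) / (1 - (norm x)\<^sup>2) ^ CARD('n)))"
    by (rule set_lebesgue_integral_cong) (use u D in \<open>auto simp: Delta_solution_def\<close>)
  ultimately show ?thesis
    by (simp add: radial_integral_def set_lebesgue_integral_def)
qed

text \<open>The two weights have a linear combination of mass zero, which \<open>u\<close> annihilates.\<close>
lemma radial_integral_proportional:
  fixes u :: "real ^ 'n \<Rightarrow> real"
  assumes u: "Delta_solution (real CARD('n) / 2 - 1) u" and a: "a \<in> ball 0 1"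
    and w: "annular_weight l b w" and v: "annular_weight l' b' v"
  shows "radial_integral u w a * radial_mass (real CARD('n)) v
    = radial_integral u v a * radial_mass (real CARD('n)) w"
proof -
  define L B where "L = min l l'" and "B = max b b'"
  have w': "annular_weight L B w" and v': "annular_weight L B v"
    using w v annular_weight_mono[OF w, of L B] annular_weight_mono[OF v, of L B]
    by (simp_all add: L_def B_def annular_weight_def)
  define J where "J = radial_mass (real CARD('n))"
  define z where "z s = J v * w s - J w * v s" for s
  have z: "annular_weight L B z"
    using w' v' unfolding annular_weight_def z_def by (auto intro!: continuous_intros)
  let ?c = "\<lambda>s. (s * (1 + s)) powr (real CARD('n) / 2 - 1)"
  have i: "(\<lambda>s. k s * ?c s) integrable_on {L..B}" if "annular_weight L B k" for k
    by (intro integrable_continuous_real continuous_on_subset[OF continuous_on_mass_integrand[OF that]]) simp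
  have "J z = integral {L..B} (\<lambda>s. J v * (w s * ?c s) - J w * (v s * ?c s))"
    unfolding J_def radial_mass_eq[OF z] by (simp add: z_def J_def algebra_simps)
  also have "\<dots> = J v * J w - J w * J v"
    unfolding J_def radial_mass_eq[OF w'] radial_mass_eq[OF v']
    using i[OF w'] i[OF v'] by (subst integral_diff) (auto simp: integrable_on_mult_right)
  finally have "J z = 0" by simp
  then have "radial_integral u z a = 0"
    unfolding J_def by (intro radial_integral_zero[OF u a z])
  moreover have "radial_integral u z a = J v * radial_integral u w a - J w * radial_integral u v a"
  proof -
    have uc: "continuous_on (ball 0 1) u" using u by (auto simp: Delta_solution_def C2_on_def C1_on_def)
    let ?k = "\<lambda>w x. u x * w (sinh_half_sq a x) / (1 - (norm x)\<^sup>2) ^ CARD('n)"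
    have "radial_integral u z a = (LINT x:ball 0 1|lborel. J v * ?k w x - J w * ?k v x)"
      unfolding radial_integral_def z_def by (simp add: algebra_simps diff_divide_distrib)
    also have "\<dots> = (LINT x:ball 0 1|lborel. J v * ?k w x) - (LINT x:ball 0 1|lborel. J w * ?k v x)"
      by (intro set_integral_diff set_integrable_mult_right radial_integrand_integrable[OF uc a w]
        radial_integrand_integrable[OF uc a v])
    finally show ?thesis by (simp only: radial_integral_def set_integral_mult_right)
  qed
  ultimately show ?thesis by (simp add: J_def mult.commute)
qed

section \<open>The mean value property\<close>

lemma radial_mass_pos:
  assumes w: "annular_weight l b w" and nn: "\<And>s. w s \<ge> 0" and pos: "w s > 0"
  shows "radial_mass n w > 0"
proof -
  let ?g = "\<lambda>s. w s * (s * (1 + s)) powr (n / 2 - 1)"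
  have c: "continuous_on {l..b} ?g"
    by (rule continuous_on_subset[OF continuous_on_mass_integrand[OF w]]) simp
  have s: "s \<in> {l..b}" "0 < l" "l < b" using w pos by (auto simp: annular_weight_def)
  then have "?g s \<noteq> 0" using pos by simp
  moreover have "integral {l..b} ?g = 0 \<longleftrightarrow> (\<forall>t\<in>{l..b}. ?g t = 0)"
    by (rule integral_eq_0_iff[OF c s(3)]) (use nn in simp)
  ultimately have "integral {l..b} ?g \<noteq> 0"
    using s(1) by blast
  moreover have "integral {l..b} ?g \<ge> 0"
    using nn by (intro integral_nonneg integrable_continuous_real c) simp
  ultimately show ?thesis unfolding radial_mass_eq[OF w] by simp
qed

text \<open>A continuous bump on \<open>{1..2}\<close>; its rescalings are thin shells around the centre.\<close>
definition tent :: "real \<Rightarrow> real" where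
  "tent t = max 0 (min (t - 1) (2 - t))"

lemma continuous_on_tent: "continuous_on UNIV tent"
  unfolding tent_def[abs_def] by (intro continuous_intros)

lemma tent_bounds: "tent t \<ge> 0" "tent t \<le> 1" "t \<notin> {1..2} \<Longrightarrow> tent t = 0"
  by (auto simp: tent_def)

lemma annular_weight_tent:
  assumes "r > 0" shows "annular_weight r (2 * r) (\<lambda>s. tent (s / r))"
  unfolding annular_weight_def
proof (intro conjI allI impI)
  show "continuous_on UNIV (\<lambda>s. tent (s / r))"
    by (rule continuous_on_compose2[OF continuous_on_tent]) (use assms in \<open>auto intro!: continuous_intros\<close>)
  show "tent (s / r) = 0" if "s \<notin> {r..2 * r}" for s
    using that assms by (intro tent_bounds(3)) (auto simp: field_simps)
qed (use assms in auto)

lemma integral_affine_lborel: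
  fixes f :: "'a::euclidean_space \<Rightarrow> real"
  assumes [measurable]: "f \<in> borel_measurable borel" and c: "c > 0"
  shows "(\<integral>y. f y \<partial>lborel) = c ^ DIM('a) * (\<integral>z. f (t + c *\<^sub>R z) \<partial>lborel)"
proof -
  have "(\<integral>y. f y \<partial>lborel) = (\<integral>y. f y \<partial>(density (distr lborel borel (\<lambda>x. t + c *\<^sub>R x)) (\<lambda>_. ennreal (c ^ DIM('a)))))"
    using lborel_affine[of c t] c by (simp add: ennreal_power)
  also have "\<dots> = (\<integral>y. c ^ DIM('a) * f y \<partial>(distr lborel borel (\<lambda>x. t + c *\<^sub>R x)))"
    using c by (subst integral_density) auto
  also have "\<dots> = c ^ DIM('a) * (\<integral>z. f (t + c *\<^sub>R z) \<partial>lborel)"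
    by (subst integral_distr) auto
  finally show ?thesis .
qed

text \<open>The radius \<open>6 / 5\<close> lies in the shell \<open>1 < |z|\<^sup>2 < 2\<close> with room for a ball of radius \<open>1 / 10\<close>.\<close>
lemma tent_shell_integral_pos: "(\<integral>z. tent ((norm z)\<^sup>2) \<partial>(lborel :: 'a::euclidean_space measure)) > 0"
proof -
  have c: "continuous_on UNIV (\<lambda>z::'a. tent ((norm z)\<^sup>2))"
    by (rule continuous_on_compose2[OF continuous_on_tent]) (auto intro!: continuous_intros)
  have int: "integrable lborel (\<lambda>z::'a. tent ((norm z)\<^sup>2))"
  proof (rule integrable_bounded_support[of _ 1 2])
    show "(\<lambda>z::'a. tent ((norm z)\<^sup>2)) \<in> borel_measurable borel"
      using c by (rule borel_measurable_continuous_onI)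
    show "tent ((norm z)\<^sup>2) = 0" if "norm z > 2" for z :: 'a
      using power_strict_mono[OF that, of 2] by (intro tent_bounds(3)) auto
  qed (use tent_bounds in auto)
  obtain e :: 'a where e: "norm e = 6 / 5"
    using vector_choose_size[of "6/5"] by auto
  have "tent ((norm z)\<^sup>2) \<ge> 1 / 100" if "z \<in> ball e (1 / 10)" for z
  proof -
    have d: "norm (z - e) < 1 / 10" using that by (simp add: dist_norm norm_minus_commute)
    have "norm z \<ge> 11 / 10" "norm z \<le> 13 / 10"
      using d e norm_triangle_ineq3[of z e] by linarith+
    then have "(norm z)\<^sup>2 \<ge> (11 / 10)\<^sup>2" "(norm z)\<^sup>2 \<le> (13 / 10)\<^sup>2"
      by (intro power_mono; simp)+
    then show ?thesis by (simp add: tent_def power2_eq_square)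
  qed
  then have "(\<integral>z. 1 / 100 * indicat_real (ball e (1 / 10)) z \<partial>lborel)
      \<le> (\<integral>z. tent ((norm z)\<^sup>2) \<partial>(lborel :: 'a measure))"
    using tent_bounds(1) emeasure_lborel_ball_finite[of e "1 / 10"]
    by (intro integral_mono int integrable_mult_right integrable_real_indicator) (auto simp: indicator_def)
  moreover have "(\<integral>z. 1 / 100 * indicat_real (ball e (1 / 10)) z \<partial>lborel) > 0"
    using content_ball_pos[of "1/10" e] by simp
  ultimately show ?thesis by linarith
qed

text \<open>Substituting \<open>y = a + (1 - |a|\<^sup>2) \<delta> z\<close> turns the shell around \<open>a\<close> into an almost Euclidean one of
  fixed size.  The factor \<open>1 - |a|\<^sup>2\<close> compensates the conformal factor \<open>2 / (1 - |a|\<^sup>2)\<close> of the metric at \<open>a\<close>, which makes the limit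
  constant the same for all centres.\<close>
lemma radial_integral_concentrates:
  fixes u :: "real ^ 'n \<Rightarrow> real"
  assumes u: "continuous_on (ball 0 1) u" and a: "a \<in> ball 0 1"
    and d0: "\<And>k. \<delta> k > 0" and dlim: "\<delta> \<longlonglongrightarrow> 0"
  shows "(\<lambda>k. radial_integral u (\<lambda>s. tent (s / (\<delta> k)\<^sup>2)) a / \<delta> k ^ CARD('n))
     \<longlonglongrightarrow> u a * (\<integral>z. tent ((norm z)\<^sup>2) \<partial>(lborel :: (real^'n) measure))"
proof -
  define A where "A = 1 - (norm a)\<^sup>2"
  define X where "X x = 1 - (norm (x::real^'n))\<^sup>2" for x
  define r where "r = (1 - norm a) / 2"
  let ?B = "ball 0 1 :: (real^'n) set"
  have A: "A > 0" "A \<le> 1" using one_minus_norm_sq_pos[OF a] by (auto simp: A_def)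
  have X: "X x > 0" "X x \<le> 1" if "x \<in> ?B" for x using one_minus_norm_sq_pos[OF that] by (auto simp: X_def)
  have r: "r > 0" using a by (simp add: r_def)
  have cb: "cball a r \<subseteq> ?B"
  proof
    fix y assume "y \<in> cball a r"
    then have "norm y \<le> norm a + r"
      using norm_triangle_ineq2[of y a] by (simp add: dist_norm norm_minus_commute)
    then show "y \<in> ?B" using a by (simp add: r_def field_simps)
  qed
  define v where "v y = u y / X y ^ CARD('n)" for y
  have vc: "continuous_on ?B v"
    unfolding v_def X_def by (intro continuous_intros u) (use X in \<open>force simp: X_def\<close>)
  have "bounded (v ` cball a r)"
    by (intro compact_imp_bounded compact_continuous_image continuous_on_subset[OF vc cb]) auto
  then obtain M where M: "M > 0" "\<And>y. y \<in> cball a r \<Longrightarrow> \<bar>v y\<bar> \<le> M"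
    by (auto simp: bounded_pos)
  define f where "f k y = indicat_real ?B y * (v y * tent (sinh_half_sq a y / (\<delta> k)\<^sup>2))" for k y
  have fm [measurable]: "f k \<in> borel_measurable borel" for k
  proof -
    have "continuous_on ?B (\<lambda>y. v y * tent (sinh_half_sq a y / (\<delta> k)\<^sup>2))"
      by (intro continuous_intros vc continuous_on_compose2[OF continuous_on_tent] continuous_on_sinh_half_sq[OF a])
        (use d0[of k] in auto)
    from borel_measurable_continuous_on_indicator[OF _ this] show ?thesis
      by (simp add: f_def[abs_def])
  qed
  define q where "q k z = A ^ CARD('n) * f k (a + (A * \<delta> k) *\<^sub>R z)" for k z
  have scaled: "radial_integral u (\<lambda>s. tent (s / (\<delta> k)\<^sup>2)) a / \<delta> k ^ CARD('n) = (\<integral>z. q k z \<partial>lborel)" for k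
  proof -
    have "radial_integral u (\<lambda>s. tent (s / (\<delta> k)\<^sup>2)) a = (\<integral>y. f k y \<partial>lborel)"
      by (simp add: radial_integral_def set_lebesgue_integral_def f_def v_def X_def)
    also have "\<dots> = (A * \<delta> k) ^ CARD('n) * (\<integral>z. f k (a + (A * \<delta> k) *\<^sub>R z) \<partial>lborel)"
      using integral_affine_lborel[OF fm, of "A * \<delta> k" k a] A d0[of k] by simp
    finally show ?thesis
      using d0[of k] by (simp add: q_def power_mult_distrib)
  qed
  have rescale: "sinh_half_sq a (a + (A * \<delta> k) *\<^sub>R z) / (\<delta> k)\<^sup>2 = A * (norm z)\<^sup>2 / X (a + (A * \<delta> k) *\<^sub>R z)" for k z
  proof -
    have "sinh_half_sq a y = (norm (y - a))\<^sup>2 / (A * X y)" for y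
      by (simp add: sinh_half_sq_def X_def A_def)
    then show ?thesis
      using A d0[of k] by (simp add: power_mult_distrib) (simp add: power2_eq_square field_simps)
  qed
  have pt: "(\<lambda>k. a + (A * \<delta> k) *\<^sub>R z) \<longlonglongrightarrow> a" for z
    using tendsto_add[OF tendsto_const tendsto_scaleR[OF tendsto_mult[OF tendsto_const dlim] tendsto_const], of a A z] by simp
  have qlim: "(\<lambda>k. q k z) \<longlonglongrightarrow> u a * tent ((norm z)\<^sup>2)" for z
  proof -
    have at: "isCont v a" using vc a by (simp add: continuous_on_eq_continuous_at)
    have v: "(\<lambda>k. v (a + (A * \<delta> k) *\<^sub>R z)) \<longlonglongrightarrow> v a"
      by (rule isCont_tendsto_compose[OF at pt])
    have "(\<lambda>k. A * (norm z)\<^sup>2 / X (a + (A * \<delta> k) *\<^sub>R z)) \<longlonglongrightarrow> A * (norm z)\<^sup>2 / A"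
      unfolding X_def A_def by (intro tendsto_intros pt[unfolded A_def]) (use A in \<open>simp add: A_def\<close>)
    then have t: "(\<lambda>k. tent (A * (norm z)\<^sup>2 / X (a + (A * \<delta> k) *\<^sub>R z))) \<longlonglongrightarrow> tent ((norm z)\<^sup>2)"
      using A continuous_on_tent
      by (intro isCont_tendsto_compose[of _ tent]) (auto simp: continuous_on_eq_continuous_at)
    have "\<forall>\<^sub>F k in sequentially. a + (A * \<delta> k) *\<^sub>R z \<in> ?B"
      using topological_tendstoD[OF pt open_ball a] .
    then have "\<forall>\<^sub>F k in sequentially.
        A ^ CARD('n) * (v (a + (A * \<delta> k) *\<^sub>R z) * tent (A * (norm z)\<^sup>2 / X (a + (A * \<delta> k) *\<^sub>R z))) = q k z"
      by eventually_elim (simp add: q_def f_def rescale)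
    note ev = this
    have "(\<lambda>k. A ^ CARD('n) * (v (a + (A * \<delta> k) *\<^sub>R z) * tent (A * (norm z)\<^sup>2 / X (a + (A * \<delta> k) *\<^sub>R z))))
       \<longlonglongrightarrow> A ^ CARD('n) * (v a * tent ((norm z)\<^sup>2))"
      by (intro tendsto_intros v t)
    moreover have "A ^ CARD('n) * v a = u a"
      using A by (simp add: v_def X_def A_def[symmetric])
    ultimately have "(\<lambda>k. A ^ CARD('n) * (v (a + (A * \<delta> k) *\<^sub>R z) * tent (A * (norm z)\<^sup>2 / X (a + (A * \<delta> k) *\<^sub>R z))))
       \<longlonglongrightarrow> u a * tent ((norm z)\<^sup>2)"
      by (simp only: mult.assoc[symmetric])
    then show ?thesis
      by (rule Lim_transform_eventually[OF _ ev])
  qed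
  \<comment> \<open>From \<open>k0\<close> on, the shells lie in the compact ball \<open>cball a r\<close>, where \<open>v\<close> is bounded.\<close>
  obtain k0 where k0: "\<And>k. k \<ge> k0 \<Longrightarrow> 2 * \<delta> k < r"
    using order_tendstoD(2)[OF dlim, of "r / 2"] r by (auto simp: eventually_sequentially field_simps)
  define D where "D z = A ^ CARD('n) * M * indicat_real (cball 0 (sqrt (2 / A))) z" for z :: "real^'n"
  have iD: "integrable lborel D" unfolding D_def
    by (intro integrable_mult_right integrable_indicator_cball)
  have qD: "norm (q (k + k0) z) \<le> D z" for k z
  proof (cases "q (k + k0) z = 0")
    case True
    then show ?thesis using A M(1) by (simp add: D_def)
  next
    case False
    define y where "y = a + (A * \<delta> (k + k0)) *\<^sub>R z"
    have yB: "y \<in> ?B" and t: "tent (A * (norm z)\<^sup>2 / X y) \<noteq> 0"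
      using False by (auto simp: q_def f_def rescale y_def indicator_def split: if_splits)
    have "A * (norm z)\<^sup>2 / X y \<le> 2" using t tent_bounds(3) by force
    then have z: "A * (norm z)\<^sup>2 \<le> 2" using X[OF yB] by (simp add: field_simps)
    then have "(norm z)\<^sup>2 \<le> 2 / A" using A by (simp add: field_simps)
    then have z': "norm z \<le> sqrt (2 / A)" by (rule real_le_rsqrt)
    have "(A * norm z)\<^sup>2 = A * (A * (norm z)\<^sup>2)" by (simp add: power2_eq_square)
    also have "\<dots> \<le> 1 * 2" using A z by (intro mult_mono) auto
    also have "\<dots> \<le> 2\<^sup>2" by simp
    finally have "A * norm z \<le> 2" by (rule power2_le_imp_le) simp
    then have "A * norm z * \<delta> (k + k0) \<le> 2 * \<delta> (k + k0)"
      using d0[of "k + k0"] by (intro mult_right_mono) auto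
    also have "\<dots> < r" by (rule k0) simp
    finally have "y \<in> cball a r" using A d0[of "k + k0"] by (simp add: y_def dist_norm mult_ac)
    then have "\<bar>v y\<bar> \<le> M" by (rule M(2))
    then have "\<bar>v y\<bar> * tent (A * (norm z)\<^sup>2 / X y) \<le> M * 1"
      using M(1) tent_bounds by (intro mult_mono) auto
    then show ?thesis using A yB z' tent_bounds(1)
      by (simp add: q_def f_def y_def[symmetric] rescale[of "k + k0" z, folded y_def] D_def abs_mult mult_left_mono mult.assoc)
  qed
  have "(\<lambda>k. \<integral>z. q (k + k0) z \<partial>lborel) \<longlonglongrightarrow> (\<integral>z. u a * tent ((norm z)\<^sup>2) \<partial>(lborel :: (real^'n) measure))"
  proof (rule integral_dominated_convergence[OF _ _ iD])
    show "(\<lambda>z::real^'n. u a * tent ((norm z)\<^sup>2)) \<in> borel_measurable lborel"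
      using borel_measurable_continuous_onI[OF continuous_on_tent] by measurable
    show "q (k + k0) \<in> borel_measurable lborel" for k
      unfolding q_def by measurable
    show "AE z in lborel. (\<lambda>k. q (k + k0) z) \<longlonglongrightarrow> u a * tent ((norm z)\<^sup>2)"
      using LIMSEQ_ignore_initial_segment[OF qlim] by simp
  qed (use qD in auto)
  then have "(\<lambda>k. \<integral>z. q k z \<partial>lborel) \<longlonglongrightarrow> u a * (\<integral>z. tent ((norm z)\<^sup>2) \<partial>(lborel :: (real^'n) measure))"
    using LIMSEQ_offset[of "\<lambda>k. \<integral>z. q k z \<partial>lborel" k0] by simp
  then show ?thesis by (simp add: scaled)
qed

text \<open>Proportionality leaves a factor \<open>C a\<close> that may depend on the centre.  Along shrinking
  shells \<open>C a\<close> times a sequence that is independent of \<open>a\<close> tends to a multiple of \<open>u a\<close>,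
  so \<open>C\<close> is proportional to \<open>u\<close>.\<close>
theorem mean_value_property:
  fixes u :: "real ^ 'n \<Rightarrow> real"
  assumes u: "Delta_solution (real CARD('n) / 2 - 1) u"
    and pos: "\<And>x. x \<in> ball 0 1 \<Longrightarrow> u x > 0"
  obtains \<kappa> where "\<kappa> > 0"
    "\<And>a l b w. a \<in> ball 0 1 \<Longrightarrow> annular_weight l b w \<Longrightarrow>
      radial_integral u w a = \<kappa> * u a * radial_mass (real CARD('n)) w"
proof -
  define J where "J = radial_mass (real CARD('n))"
  define K where "K = (\<integral>z. tent ((norm z)\<^sup>2) \<partial>(lborel :: (real^'n) measure))"
  define C where "C a = radial_integral u tent a / J tent" for a
  define \<delta> :: "nat \<Rightarrow> real" where "\<delta> k = 1 / real (Suc k)" for k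
  have uc: "continuous_on (ball 0 1) u" using u by (auto simp: Delta_solution_def C2_on_def C1_on_def)
  have K: "K > 0" unfolding K_def by (rule tent_shell_integral_pos)
  have wt: "annular_weight 1 2 tent" using annular_weight_tent[of 1] by simp
  have Jt: "J tent > 0" unfolding J_def
    by (rule radial_mass_pos[OF wt tent_bounds(1), of "3/2"]) (simp add: tent_def)
  have IC: "radial_integral u w a = C a * J w" if "a \<in> ball 0 1" "annular_weight l b w" for a l b w
    using radial_integral_proportional[OF u that wt] Jt by (simp add: C_def J_def field_simps)
  define c where "c k = J (\<lambda>s. tent (s / (\<delta> k)\<^sup>2)) / \<delta> k ^ CARD('n)" for k
  have \<delta>: "\<delta> k > 0" for k by (simp add: \<delta>_def)
  have \<delta>lim: "\<delta> \<longlonglongrightarrow> 0" unfolding \<delta>_def by (rule LIMSEQ_Suc[OF lim_1_over_n])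
  have lim: "(\<lambda>k. C a * c k) \<longlonglongrightarrow> u a * K" if a: "a \<in> ball 0 1" for a
  proof -
    have "radial_integral u (\<lambda>s. tent (s / (\<delta> k)\<^sup>2)) a / \<delta> k ^ CARD('n) = C a * c k" for k
      using IC[OF a annular_weight_tent, of "(\<delta> k)\<^sup>2"] \<delta>[of k] by (simp add: c_def)
    then show ?thesis
      using radial_integral_concentrates[OF uc a \<delta> \<delta>lim] by (simp add: K_def)
  qed
  have cross: "C a * u b = C b * u a" if "a \<in> ball 0 1" "b \<in> ball 0 1" for a b
  proof -
    have "(\<lambda>k. C b * (C a * c k)) \<longlonglongrightarrow> C b * (u a * K)"
      by (intro tendsto_intros lim that)
    moreover have "(\<lambda>k. C a * (C b * c k)) \<longlonglongrightarrow> C a * (u b * K)"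
      by (intro tendsto_intros lim that)
    ultimately have "C b * (u a * K) = C a * (u b * K)"
      by (intro LIMSEQ_unique[of "\<lambda>k. C b * (C a * c k)"]) (simp_all add: mult.left_commute)
    then show ?thesis using K by simp
  qed
  have u0: "u 0 > 0" by (rule pos) simp
  have "C 0 \<ge> 0"
  proof -
    have "0 \<le> u x * tent (sinh_half_sq 0 x) / (1 - (norm x)\<^sup>2) ^ CARD('n)" if "x \<in> ball 0 1" for x
      using pos[OF that] one_minus_norm_sq_pos[OF that] tent_bounds(1)
      by (intro divide_nonneg_nonneg mult_nonneg_nonneg) auto
    then have "radial_integral u tent 0 \<ge> 0"
      unfolding radial_integral_def set_lebesgue_integral_def
      by (intro Bochner_Integration.integral_nonneg) (auto simp: indicator_def)
    then show ?thesis using Jt by (simp add: C_def)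
  qed
  moreover have "C 0 \<noteq> 0"
  proof
    assume "C 0 = 0"
    then have "u 0 * K = 0" using lim[of 0] by (simp add: LIMSEQ_const_iff)
    then show False using u0 K by simp
  qed
  ultimately have "C 0 / u 0 > 0" using u0 by simp
  moreover have "radial_integral u w a = C 0 / u 0 * u a * J w" if "a \<in> ball 0 1" "annular_weight l b w" for a l b w
    using IC[OF that] cross[OF that(1), of 0] u0 by (simp add: field_simps)
  ultimately show ?thesis using that unfolding J_def by blast
qed

section \<open>The sharp Harnack inequality\<close>

text \<open>The offset \<open>2\<close> keeps the support \<open>{1 / (k + 2)..k + 2}\<close> nondegenerate for every \<open>k\<close>.\<close>
definition cutoff :: "nat \<Rightarrow> real \<Rightarrow> real" where
  "cutoff k s = max 0 (min 1 (min (real (k + 2) * s - 1) (real (k + 2) - s)))"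

text \<open>The power \<open>(1 + s)\<^sup>-\<^sup>c = cosh\<^sup>-\<^sup>2\<^sup>c (d / 2)\<close> is comparable to \<open>e\<^sup>-\<^sup>c\<^sup>d\<close>.  The cutoff makes it an annular weight
  and tends to \<open>1\<close> for every \<open>s > 0\<close>.\<close>
definition power_weight :: "real \<Rightarrow> nat \<Rightarrow> real \<Rightarrow> real" where
  "power_weight c k s = (1 + s) powr (- c) * cutoff k s"

lemma cutoff_bounds: "0 \<le> cutoff k s" "cutoff k s \<le> 1"
  by (auto simp: cutoff_def)

lemma cutoff_zero: "s \<notin> {1 / real (k + 2)..real (k + 2)} \<Longrightarrow> cutoff k s = 0"
  by (auto simp: cutoff_def field_simps)

lemma cutoff_tendsto_1:
  assumes "s > 0" shows "(\<lambda>k. cutoff k s) \<longlonglongrightarrow> 1"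
proof (rule tendsto_eventually)
  obtain m where m: "real m > 2 / s + s + 1" using reals_Archimedean2 by blast
  have "cutoff k s = 1" if "k \<ge> m" for k
  proof -
    have k: "real (k + 2) > 2 / s + s + 1" using m that by simp
    have "2 / s > 0" using assms by simp
    then have "real (k + 2) - s \<ge> 1" "real (k + 2) \<ge> 2 / s" using k assms by linarith+
    then show ?thesis using assms by (simp add: cutoff_def field_simps)
  qed
  then show "\<forall>\<^sub>F k in sequentially. cutoff k s = 1" by (auto simp: eventually_sequentially)
qed

lemma annular_weight_power:
  "annular_weight (1 / real (k + 2)) (real (k + 2)) (power_weight c k)"
  unfolding annular_weight_def
proof (intro conjI allI impI)
  show "continuous_on UNIV (power_weight c k)"
  proof (rule continuous_on_vanishing_left[of "1 / real (k + 2)"])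
    show "continuous_on {0<..} (power_weight c k)"
      unfolding power_weight_def[abs_def] cutoff_def by (intro continuous_intros) auto
    show "power_weight c k s = 0" if "s < 1 / real (k + 2)" for s
      using cutoff_zero[of s k] that by (simp add: power_weight_def)
  qed simp
  show "power_weight c k s = 0" if "s \<notin> {1 / real (k + 2)..real (k + 2)}" for s
    using cutoff_zero[OF that] by (simp add: power_weight_def)
  have "1 / real (k + 2) < 1" by simp
  also have "1 < real (k + 2)" by simp
  finally show "1 / real (k + 2) < real (k + 2)" .
qed simp

text \<open>As \<open>s (1 + s) \<le> (1 + s)\<^sup>2\<close>, the mass density is at most \<open>(1 + s)\<^sup>-\<^sup>1\<^sup>-\<^sup>\<eta>\<close>.  This is
  where the exponent \<open>n - 1\<close> is critical: the masses stay bounded just above it.\<close>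
lemma radial_mass_power_weight_le:
  assumes n: "n \<ge> 2" and \<eta>: "\<eta> > 0"
  shows "radial_mass n (power_weight (n - 1 + \<eta>) k) \<le> 1 / \<eta>"
proof -
  define l b where "l = 1 / real (k + 2)" and "b = real (k + 2)"
  have w: "annular_weight l b (power_weight (n - 1 + \<eta>) k)"
    unfolding l_def b_def by (rule annular_weight_power)
  then have lb: "0 < l" "l < b" by (auto simp: annular_weight_def)
  have "radial_mass n (power_weight (n - 1 + \<eta>) k)
      = integral {l..b} (\<lambda>s. power_weight (n - 1 + \<eta>) k s * (s * (1 + s)) powr (n / 2 - 1))"
    by (rule radial_mass_eq[OF w])
  also have "\<dots> \<le> integral {l..b} (\<lambda>s. (1 + s) powr (- 1 - \<eta>))"
  proof (rule integral_le)
    show "(\<lambda>s. power_weight (n - 1 + \<eta>) k s * (s * (1 + s)) powr (n / 2 - 1)) integrable_on {l..b}"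
      by (intro integrable_continuous_real continuous_on_subset[OF continuous_on_mass_integrand[OF w]]) simp
    show "(\<lambda>s. (1 + s) powr (- 1 - \<eta>)) integrable_on {l..b}"
      using lb by (intro integrable_continuous_real continuous_intros) auto
    fix s assume "s \<in> {l..b}"
    then have s: "s > 0" using lb by simp
    have "(s * (1 + s)) powr (n / 2 - 1) \<le> ((1 + s) * (1 + s)) powr (n / 2 - 1)"
      using s n by (intro powr_mono2 mult_mono) auto
    also have "\<dots> = (1 + s) powr (n - 2)"
      using s by (simp add: powr_mult powr_add[symmetric])
    finally have "power_weight (n - 1 + \<eta>) k s * (s * (1 + s)) powr (n / 2 - 1)
        \<le> ((1 + s) powr (- (n - 1 + \<eta>)) * 1) * (1 + s) powr (n - 2)"
      unfolding power_weight_def using cutoff_bounds by (intro mult_mono) auto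
    also have "\<dots> = (1 + s) powr (- 1 - \<eta>)"
      by (simp add: powr_add[symmetric])
    finally show "power_weight (n - 1 + \<eta>) k s * (s * (1 + s)) powr (n / 2 - 1) \<le> (1 + s) powr (- 1 - \<eta>)" .
  qed
  also have "\<dots> = - ((1 + b) powr - \<eta>) / \<eta> - - ((1 + l) powr - \<eta>) / \<eta>"
  proof (rule integral_unique, rule fundamental_theorem_of_calculus)
    fix s assume "s \<in> {l..b}"
    then have "1 + s > 0" using lb by simp
    then have "((\<lambda>s. (1 + s) powr - \<eta>) has_real_derivative - \<eta> * (1 + s) powr (- \<eta> - 1)) (at s)"
      using DERIV_fun_powr[of "\<lambda>s. 1 + s" 1 s "- \<eta>"] by (auto intro!: derivative_eq_intros)
    from DERIV_cdivide[OF DERIV_minus[OF this], of \<eta>]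
    have "((\<lambda>s. - ((1 + s) powr - \<eta>) / \<eta>) has_real_derivative (1 + s) powr (- \<eta> - 1)) (at s)"
      using \<eta> by simp
    moreover have "- \<eta> - 1 = - 1 - \<eta>" by simp
    ultimately have "((\<lambda>s. - ((1 + s) powr - \<eta>) / \<eta>) has_real_derivative (1 + s) powr (- 1 - \<eta>)) (at s)"
      by (simp only:)
    then show "((\<lambda>s. - ((1 + s) powr - \<eta>) / \<eta>) has_vector_derivative (1 + s) powr (- 1 - \<eta>)) (at s within {l..b})"
      by (simp add: has_real_derivative_iff_has_vector_derivative[symmetric] has_field_derivative_at_within)
  qed (use lb in simp)
  also have "\<dots> \<le> 1 / \<eta>"
  proof -
    have "(1 + l) powr - \<eta> \<le> 1 powr - \<eta>" using lb \<eta> by (intro powr_mono2') auto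
    moreover have "(1 + b) powr - \<eta> \<ge> 0" by simp
    ultimately have "(1 + l) powr - \<eta> - (1 + b) powr - \<eta> \<le> 1" by (simp only: powr_one_eq_one)
    from divide_right_mono[OF this, of \<eta>] show ?thesis using \<eta> by (simp add: diff_divide_distrib)
  qed
  finally show ?thesis .
qed

text \<open>The weights centred at \<open>a\<close> and \<open>b\<close> are comparable, but their cutoffs are not.  So the weight at \<open>b\<close>
  is fixed and multiplied by the cutoffs around \<open>a\<close>: this product is at most \<open>\<rho>\<^sup>c\<close> times the weights at \<open>a\<close>, and
  it converges to the weight at \<open>b\<close>.  The masses on both sides then have the same supremum,
  which cancels.\<close>
lemma Harnack_power:
  fixes u :: "real ^ 'n \<Rightarrow> real"
  assumes n: "CARD('n) \<ge> 2" and u: "Delta_solution (real CARD('n) / 2 - 1) u"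
    and pos: "\<And>x. x \<in> ball 0 1 \<Longrightarrow> u x > 0"
    and a: "a \<in> ball 0 1" and b: "b \<in> ball 0 1" and \<rho>: "\<rho> > 0"
    and cmp: "\<And>y. y \<in> ball 0 1 \<Longrightarrow> 1 + sinh_half_sq a y \<le> \<rho> * (1 + sinh_half_sq b y)"
    and \<eta>: "\<eta> > 0"
  shows "u b \<le> \<rho> powr (real CARD('n) - 1 + \<eta>) * u a"
proof -
  define n where "n = real CARD('n)"
  define c where "c = n - 1 + \<eta>"
  define W where "W = power_weight c"
  have n2: "n \<ge> 2" using n by (simp add: n_def)
  have c: "c > 0" using n2 \<eta> by (simp add: c_def)
  have uc: "continuous_on (ball 0 1) u" using u by (auto simp: Delta_solution_def C2_on_def C1_on_def)
  obtain \<kappa> where \<kappa>: "\<kappa> > 0"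
    "\<And>a l b w. a \<in> ball 0 1 \<Longrightarrow> annular_weight l b w \<Longrightarrow> radial_integral u w a = \<kappa> * u a * radial_mass n w"
    using mean_value_property[OF u pos] unfolding n_def by metis
  have Wa: "annular_weight (1 / real (k + 2)) (real (k + 2)) (W k)" for k
    unfolding W_def by (rule annular_weight_power)
  have I: "radial_integral u (W k) x = \<kappa> * u x * radial_mass n (W k)" if "x \<in> ball 0 1" for k x
    by (rule \<kappa>(2)[OF that Wa])
  \<comment> \<open>The common supremum of the masses, finite because \<open>\<eta> > 0\<close>.\<close>
  define S where "S = (SUP k. radial_mass n (W k))"
  have bdd: "bdd_above (range (\<lambda>k. radial_mass n (W k)))"
    using radial_mass_power_weight_le[OF n2 \<eta>] by (auto simp: W_def c_def intro!: bdd_aboveI)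
  have leS: "radial_mass n (W k) \<le> S" for k
    unfolding S_def by (rule cSUP_upper[OF _ bdd]) simp
  have "radial_mass n (W 1) > 0"
    by (rule radial_mass_pos[OF Wa, of _ 1]) (auto simp: W_def power_weight_def cutoff_def)
  with leS[of 1] have S: "S > 0" by linarith
  let ?B = "ball 0 1 :: (real ^ 'n) set"
  let ?X = "\<lambda>y::real^'n. (1 - (norm y)\<^sup>2) ^ CARD('n)"
  have X: "?X y > 0" if "y \<in> ?B" for y using one_minus_norm_sq_pos[OF that] by simp
  have "u b * radial_mass n (W m) \<le> \<rho> powr c * u a * S" for m
  proof -
    define f where "f y = indicat_real ?B y * (u y * W m (sinh_half_sq b y) / ?X y)" for y
    define h where "h k y = f y * cutoff k (sinh_half_sq a y)" for k y
    have fi: "integrable lborel f"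
      using radial_integrand_integrable[OF uc b Wa[of m]] by (simp add: set_integrable_def f_def[abs_def])
    have cm: "(\<lambda>y. indicat_real ?B y * cutoff k (sinh_half_sq a y)) \<in> borel_measurable borel" for k
    proof -
      have "continuous_on ?B (\<lambda>y. cutoff k (sinh_half_sq a y))"
        unfolding cutoff_def by (intro continuous_intros continuous_on_sinh_half_sq[OF a])
      from borel_measurable_continuous_on_indicator[OF _ this] show ?thesis by simp
    qed
    have hm: "h k \<in> borel_measurable lborel" for k
    proof -
      have "h k = (\<lambda>y. f y * (indicat_real ?B y * cutoff k (sinh_half_sq a y)))"
        by (auto simp: h_def f_def indicator_def fun_eq_iff)
      then show ?thesis using cm[of k] borel_measurable_integrable[OF fi] by simp
    qed
    have hf: "norm (h k y) \<le> norm (f y)" for k y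
      unfolding h_def norm_mult using cutoff_bounds[of k "sinh_half_sq a y"]
      by (intro mult_left_le) auto
    have hlim: "AE y in lborel. (\<lambda>k. h k y) \<longlonglongrightarrow> f y"
      using AE_lborel_singleton[of a]
    proof eventually_elim
      fix y assume "y \<noteq> a"
      show "(\<lambda>k. h k y) \<longlonglongrightarrow> f y"
      proof (cases "y \<in> ?B")
        case True
        then have "sinh_half_sq a y > 0"
          using \<open>y \<noteq> a\<close> one_minus_norm_sq_pos[OF a] one_minus_norm_sq_pos[OF True]
          by (simp add: sinh_half_sq_def)
        from tendsto_mult[OF tendsto_const cutoff_tendsto_1[OF this], of "f y"]
        show ?thesis by (simp add: h_def)
      qed (simp add: h_def f_def)
    qed
    have fi': "integrable lborel (\<lambda>y. norm (f y))" using fi by simp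
    have hi: "integrable lborel (h k)" for k
      by (rule Bochner_Integration.integrable_bound[OF fi hm]) (use hf in auto)
    have lim: "(\<lambda>k. \<integral>y. h k y \<partial>lborel) \<longlonglongrightarrow> (\<integral>y. f y \<partial>lborel)"
      by (rule integral_dominated_convergence[OF _ hm fi' hlim]) (use fi hf in auto)
    have upper: "(\<integral>y. h k y \<partial>lborel) \<le> \<rho> powr c * (\<kappa> * u a * S)" for k
    proof -
      have le: "h k y \<le> \<rho> powr c * (indicat_real ?B y * (u y * W k (sinh_half_sq a y) / ?X y))" for y
      proof (cases "y \<in> ?B")
        case True
        define sa sb where "sa = sinh_half_sq a y" and "sb = sinh_half_sq b y"
        have s: "sa \<ge> 0" "sb \<ge> 0"
          using sinh_half_sq_nonneg a b True by (auto simp: sa_def sb_def)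
        have "(1 + sb) powr (- c) \<le> \<rho> powr c * (1 + sa) powr (- c)"
        proof -
          have "(\<rho> * (1 + sb)) powr (- c) \<le> (1 + sa) powr (- c)"
            using cmp[OF True] s c by (intro powr_mono2') (auto simp: sa_def sb_def)
          then have "\<rho> powr c * (\<rho> powr (- c) * (1 + sb) powr (- c)) \<le> \<rho> powr c * (1 + sa) powr (- c)"
            using \<rho> s by (intro mult_left_mono) (auto simp: powr_mult)
          moreover have "\<rho> powr c * \<rho> powr (- c) = 1" using \<rho> by (simp add: powr_add[symmetric])
          ultimately show ?thesis by (simp add: mult.assoc[symmetric])
        qed
        then have "W m sb * cutoff k sa \<le> (\<rho> powr c * (1 + sa) powr (- c)) * cutoff k sa"
          unfolding W_def power_weight_def using cutoff_bounds[of m sb] cutoff_bounds[of k sa]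
          by (intro mult_right_mono) (auto intro: order_trans[OF mult_left_le])
        then have "u y / ?X y * (W m sb * cutoff k sa) \<le> u y / ?X y * (\<rho> powr c * W k sa)"
          using pos[OF True] X[OF True]
          by (intro mult_left_mono) (auto simp: W_def power_weight_def mult.assoc)
        then show ?thesis using True
          by (simp add: h_def f_def sa_def sb_def mult_ac)
      qed (simp add: h_def f_def)
      have "(\<integral>y. h k y \<partial>lborel) \<le> (\<integral>y. \<rho> powr c * (indicat_real ?B y * (u y * W k (sinh_half_sq a y) / ?X y)) \<partial>lborel)"
        using radial_integrand_integrable[OF uc a Wa[of k]] le
        by (intro integral_mono hi integrable_mult_right) (auto simp: set_integrable_def)
      also have "\<dots> = \<rho> powr c * radial_integral u (W k) a"
        unfolding radial_integral_def set_lebesgue_integral_def real_scaleR_def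
        by (rule integral_mult_right_zero)
      also have "\<dots> \<le> \<rho> powr c * (\<kappa> * u a * S)"
        unfolding I[OF a] using \<kappa>(1) pos[OF a] leS by (intro mult_left_mono) auto
      finally show ?thesis .
    qed
    have "\<kappa> * u b * radial_mass n (W m) = (\<integral>y. f y \<partial>lborel)"
      unfolding I[OF b, symmetric] by (simp add: radial_integral_def set_lebesgue_integral_def f_def)
    also have "\<dots> \<le> \<rho> powr c * (\<kappa> * u a * S)"
      by (rule LIMSEQ_le_const2[OF lim]) (use upper in blast)
    finally have "\<kappa> * (u b * radial_mass n (W m)) \<le> \<kappa> * (\<rho> powr c * u a * S)" by (simp add: mult_ac)
    then show ?thesis using \<kappa>(1) by simp
  qed
  then have "radial_mass n (W m) \<le> \<rho> powr c * u a * S / u b" for m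
    using pos[OF b] by (simp add: field_simps)
  then have "S \<le> \<rho> powr c * u a * S / u b"
    unfolding S_def by (intro cSUP_least) auto
  then have "S * u b \<le> S * (\<rho> powr c * u a)" using pos[OF b] by (simp add: field_simps)
  then show ?thesis using S by (simp add: c_def n_def)
qed

text \<open>The hypothesis holds with \<open>\<rho> = e\<^sup>d\<close> for the distance \<open>d\<close> of \<open>a\<close> and \<open>b\<close>, by the triangle inequality
  and \<open>1 + s = cosh\<^sup>2 (d / 2)\<close>.\<close>
theorem Harnack_inequality:
  fixes u :: "real ^ 'n \<Rightarrow> real"
  assumes n: "CARD('n) \<ge> 2" and u: "Delta_solution (real CARD('n) / 2 - 1) u"
    and pos: "\<And>x. x \<in> ball 0 1 \<Longrightarrow> u x > 0"
    and a: "a \<in> ball 0 1" and b: "b \<in> ball 0 1" and \<rho>: "\<rho> > 0"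
    and cmp: "\<And>y. y \<in> ball 0 1 \<Longrightarrow> 1 + sinh_half_sq a y \<le> \<rho> * (1 + sinh_half_sq b y)"
  shows "u b \<le> \<rho> ^ (CARD('n) - 1) * u a"
proof -
  have "(\<lambda>k. \<rho> powr (real CARD('n) - 1 + 1 / real (Suc k)) * u a) \<longlonglongrightarrow> \<rho> powr (real CARD('n) - 1 + 0) * u a"
    using \<rho> by (intro tendsto_intros LIMSEQ_Suc[OF lim_1_over_n]) auto
  then have "u b \<le> \<rho> powr (real CARD('n) - 1 + 0) * u a"
    by (rule LIMSEQ_le_const) (auto intro!: Harnack_power[OF n u pos a b \<rho> cmp])
  also have "\<rho> powr (real CARD('n) - 1 + 0) = \<rho> ^ (CARD('n) - 1)"
    using \<rho> n by (simp add: powr_realpow[symmetric] of_nat_diff)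
  finally show ?thesis .
qed

section \<open>Comparison along a radius\<close>

lemma one_plus_sinh_half_sq:
  fixes a y :: "'a::real_inner"
  assumes "a \<in> ball 0 1" "y \<in> ball 0 1"
  shows "1 + sinh_half_sq a y = (1 - 2 * (a \<bullet> y) + (norm a)\<^sup>2 * (norm y)\<^sup>2) / ((1 - (norm a)\<^sup>2) * (1 - (norm y)\<^sup>2))"
proof -
  have p: "1 - (norm a)\<^sup>2 > 0" "1 - (norm y)\<^sup>2 > 0" using assms one_minus_norm_sq_pos by auto
  have e: "(norm (y - a))\<^sup>2 = (norm y)\<^sup>2 - 2 * (a \<bullet> y) + (norm a)\<^sup>2"
    by (simp add: power2_norm_eq_inner inner_diff inner_commute)
  show ?thesis unfolding sinh_half_sq_def e using p by (simp add: divide_simps) (simp add: algebra_simps)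
qed

text \<open>With \<open>q v = 1 - 2 v c + v\<^sup>2 Y\<close>, the quotient \<open>q v / (1 - v)\<^sup>2\<close> increases and
  \<open>q v / (1 + v)\<^sup>2\<close> decreases in \<open>v\<close>.  Each difference has the factor \<open>t - r\<close>, and the
  cofactor is affine in \<open>Y\<close>; it is smallest at \<open>Y = c\<^sup>2\<close> in the first case and at \<open>Y = 1\<close> in the second, where
  it factors into nonnegative terms.\<close>
lemma ray_quotient_monotonicity:
  fixes c Y r t :: real
  assumes rt: "0 \<le> r" "r \<le> t" "t < 1" and c: "\<bar>c\<bar> \<le> 1" "c\<^sup>2 \<le> Y" "Y \<le> 1"
  shows "(1 - 2 * r * c + r\<^sup>2 * Y) * (1 - t)\<^sup>2 \<le> (1 - 2 * t * c + t\<^sup>2 * Y) * (1 - r)\<^sup>2"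
    and "(1 - 2 * t * c + t\<^sup>2 * Y) * (1 + r)\<^sup>2 \<le> (1 - 2 * r * c + r\<^sup>2 * Y) * (1 + t)\<^sup>2"
proof -
  have rt1: "r * t \<le> 1" using rt mult_mono[of r 1 t 1] by simp
  have b: "t + r - 2 * r * t \<ge> 0"
    using rt mult_nonneg_nonneg[of t "1 - r"] mult_nonneg_nonneg[of r "1 - t"] by (simp add: algebra_simps)
  have "2 - r - t - c * (t + r - 2 * r * t) \<ge> 2 - r - t - 1 * (t + r - 2 * r * t)"
    using b c by (intro diff_left_mono mult_right_mono) auto
  also have "2 - r - t - 1 * (t + r - 2 * r * t) = 2 * ((1 - r) * (1 - t))" by (simp add: algebra_simps)
  also have "\<dots> \<ge> 0" using rt by simp
  finally have "(1 - c) * (2 - r - t - c * (t + r - 2 * r * t)) \<ge> 0" using c by (intro mult_nonneg_nonneg) auto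
  moreover have "c\<^sup>2 * (t + r - 2 * r * t) \<le> Y * (t + r - 2 * r * t)" using b c by (intro mult_right_mono)
  ultimately have "2 - r - t - 2 * c * (1 - r * t) + Y * (t + r - 2 * r * t) \<ge> 0"
    by (simp add: algebra_simps power2_eq_square)
  then have "(t - r) * (2 - r - t - 2 * c * (1 - r * t) + Y * (t + r - 2 * r * t)) \<ge> 0"
    using rt by (intro mult_nonneg_nonneg) auto
  then show "(1 - 2 * r * c + r\<^sup>2 * Y) * (1 - t)\<^sup>2 \<le> (1 - 2 * t * c + t\<^sup>2 * Y) * (1 - r)\<^sup>2"
    by (simp add: algebra_simps power2_eq_square)
  have "Y * (t + r + 2 * r * t) \<le> 1 * (t + r + 2 * r * t)" using rt c by (intro mult_right_mono) auto
  moreover have "(1 + c) * (1 - r * t) \<ge> 0" using rt1 c by (intro mult_nonneg_nonneg) auto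
  ultimately have "2 + r + t + 2 * c * (1 - r * t) - Y * (t + r + 2 * r * t) \<ge> 0"
    by (simp add: algebra_simps)
  then have "(t - r) * (2 + r + t + 2 * c * (1 - r * t) - Y * (t + r + 2 * r * t)) \<ge> 0"
    using rt by (intro mult_nonneg_nonneg) auto
  then show "(1 - 2 * t * c + t\<^sup>2 * Y) * (1 + r)\<^sup>2 \<le> (1 - 2 * r * c + r\<^sup>2 * Y) * (1 + t)\<^sup>2"
    by (simp add: algebra_simps power2_eq_square)
qed

text \<open>Here \<open>\<rho> = e\<^sup>d\<close> for the hyperbolic distance \<open>d\<close> of the two points \<open>r \<zeta>\<close> and \<open>t \<zeta>\<close>.\<close>
lemma one_plus_sinh_half_sq_on_ray:
  fixes \<zeta> y :: "'a::real_inner"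
  assumes rt: "0 \<le> r" "r \<le> t" "t < 1" and \<zeta>: "norm \<zeta> = 1" and y: "y \<in> ball 0 1"
  defines "\<rho> \<equiv> ((1 + t) * (1 - r)) / ((1 - t) * (1 + r))"
  shows "1 + sinh_half_sq (r *\<^sub>R \<zeta>) y \<le> \<rho> * (1 + sinh_half_sq (t *\<^sub>R \<zeta>) y)"
    and "1 + sinh_half_sq (t *\<^sub>R \<zeta>) y \<le> \<rho> * (1 + sinh_half_sq (r *\<^sub>R \<zeta>) y)"
proof -
  define c Y where "c = \<zeta> \<bullet> y" and "Y = (norm y)\<^sup>2"
  have cy: "\<bar>c\<bar> \<le> norm y" using Cauchy_Schwarz_ineq2[of \<zeta> y] \<zeta> by (simp add: c_def)
  have Y: "Y < 1" using one_minus_norm_sq_pos[OF y] by (simp add: Y_def)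
  have c: "\<bar>c\<bar> \<le> 1" "c\<^sup>2 \<le> Y" "Y \<le> 1"
    using cy y Y power_mono[OF cy, of 2] by (auto simp: Y_def)
  define q where "q r = 1 - 2 * r * c + r\<^sup>2 * Y" for r
  have s: "1 + sinh_half_sq (v *\<^sub>R \<zeta>) y = q v / ((1 - v) * (1 + v) * (1 - Y))" if "0 \<le> v" "v < 1" for v
  proof -
    have "v *\<^sub>R \<zeta> \<in> ball 0 1" using that \<zeta> by simp
    moreover have "1 - (norm (v *\<^sub>R \<zeta>))\<^sup>2 = (1 - v) * (1 + v)"
      using that \<zeta> by (simp add: power2_eq_square algebra_simps)
    ultimately show ?thesis
      using \<zeta> by (simp add: one_plus_sinh_half_sq[OF _ y] q_def c_def Y_def power_mult_distrib)
  qed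
  note m = ray_quotient_monotonicity[OF rt c, folded q_def]
  have p: "1 - r > 0" "1 - t > 0" "1 + r > 0" "1 + t > 0" "1 - Y > 0" using rt Y by auto
  have "q r / ((1 - r) * (1 + r)) \<le> \<rho> * (q t / ((1 - t) * (1 + t)))"
    using m(1) p by (simp add: \<rho>_def divide_simps power2_eq_square mult_ac)
  from divide_right_mono[OF this, of "1 - Y"] p
  show "1 + sinh_half_sq (r *\<^sub>R \<zeta>) y \<le> \<rho> * (1 + sinh_half_sq (t *\<^sub>R \<zeta>) y)"
    using rt by (simp add: s)
  have "q t / ((1 - t) * (1 + t)) \<le> \<rho> * (q r / ((1 - r) * (1 + r)))"
    using m(2) p by (simp add: \<rho>_def divide_simps power2_eq_square mult_ac)
  from divide_right_mono[OF this, of "1 - Y"] p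
  show "1 + sinh_half_sq (t *\<^sub>R \<zeta>) y \<le> \<rho> * (1 + sinh_half_sq (r *\<^sub>R \<zeta>) y)"
    using rt by (simp add: s)
qed

theorem corollary1p4:
  fixes u :: "real ^ 'n \<Rightarrow> real" and \<zeta> :: "real ^ 'n"
  assumes "CARD('n) \<ge> 2"
    and "Delta_solution (real CARD('n) / 2 - 1) u"
    and "\<And>x. x \<in> ball 0 1 \<Longrightarrow> u x > 0"
    and "\<zeta> \<in> sphere 0 1"
  shows "antimono_on {0..<1} (\<lambda>r::real. ((1 - r) / (1 + r)) ^ (CARD('n) - 1) * u (r *\<^sub>R \<zeta>))
       \<and> mono_on {0..<1} (\<lambda>r::real. ((1 + r) / (1 - r)) ^ (CARD('n) - 1) * u (r *\<^sub>R \<zeta>))"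
proof -
  define m where "m = CARD('n) - 1"
  have \<zeta>: "norm \<zeta> = 1" using assms(4) by simp
  have main: "((1 - t) / (1 + t)) ^ m * u (t *\<^sub>R \<zeta>) \<le> ((1 - r) / (1 + r)) ^ m * u (r *\<^sub>R \<zeta>)"
    "((1 + r) / (1 - r)) ^ m * u (r *\<^sub>R \<zeta>) \<le> ((1 + t) / (1 - t)) ^ m * u (t *\<^sub>R \<zeta>)"
    if rt: "0 \<le> r" "r \<le> t" "t < 1" for r t
  proof -
    define \<rho> where "\<rho> = ((1 + t) * (1 - r)) / ((1 - t) * (1 + r))"
    have p: "1 - r > 0" "1 - t > 0" "1 + r > 0" "1 + t > 0" using rt by auto
    then have \<rho>: "\<rho> > 0" by (simp add: \<rho>_def)
    have B: "r *\<^sub>R \<zeta> \<in> ball 0 1" "t *\<^sub>R \<zeta> \<in> ball 0 1" using rt \<zeta> by auto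
    note cmp = one_plus_sinh_half_sq_on_ray[OF rt \<zeta>, folded \<rho>_def]
    have "u (t *\<^sub>R \<zeta>) \<le> \<rho> ^ m * u (r *\<^sub>R \<zeta>)"
      unfolding m_def by (rule Harnack_inequality[OF assms(1-3) B(1,2) \<rho> cmp(1)])
    then have "((1 - t) / (1 + t)) ^ m * u (t *\<^sub>R \<zeta>) \<le> ((1 - t) / (1 + t)) ^ m * (\<rho> ^ m * u (r *\<^sub>R \<zeta>))"
      using p by (intro mult_left_mono) auto
    also have "\<dots> = ((1 - t) / (1 + t) * \<rho>) ^ m * u (r *\<^sub>R \<zeta>)" by (simp only: power_mult_distrib mult.assoc)
    also have "(1 - t) / (1 + t) * \<rho> = (1 - r) / (1 + r)" using p by (simp add: \<rho>_def divide_simps)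
    finally show "((1 - t) / (1 + t)) ^ m * u (t *\<^sub>R \<zeta>) \<le> ((1 - r) / (1 + r)) ^ m * u (r *\<^sub>R \<zeta>)" .
    have "u (r *\<^sub>R \<zeta>) \<le> \<rho> ^ m * u (t *\<^sub>R \<zeta>)"
      unfolding m_def by (rule Harnack_inequality[OF assms(1-3) B(2,1) \<rho> cmp(2)])
    then have "((1 + r) / (1 - r)) ^ m * u (r *\<^sub>R \<zeta>) \<le> ((1 + r) / (1 - r)) ^ m * (\<rho> ^ m * u (t *\<^sub>R \<zeta>))"
      using p by (intro mult_left_mono) auto
    also have "\<dots> = ((1 + r) / (1 - r) * \<rho>) ^ m * u (t *\<^sub>R \<zeta>)" by (simp only: power_mult_distrib mult.assoc)
    also have "(1 + r) / (1 - r) * \<rho> = (1 + t) / (1 - t)" using p by (simp add: \<rho>_def divide_simps)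
    finally show "((1 + r) / (1 - r)) ^ m * u (r *\<^sub>R \<zeta>) \<le> ((1 + t) / (1 - t)) ^ m * u (t *\<^sub>R \<zeta>)" .
  qed
  show ?thesis
    unfolding m_def[symmetric] by (intro conjI monotone_onI main) auto
qed


end
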